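(* Let $\mathsf{M}$ be a coloopless matroid of corank $2$ and cardinality $n$. Then $Z_{\mathsf{M}}(t)$ is coefficient-wise smaller than or equal to $Z_{\mathsf{U}_{n-2,n}}(t)$; that is, for every $i$, the coefficient of $t^i$ in $Z_{\mathsf{M}}(t)$ is at most the coefficient of $t^i$ in $Z_{\mathsf{U}_{n-2,n}}(t)$.
   Context: $\mathsf{U}_{k,n}$ is the uniform matroid of rank $k$ on $n$ elements; corank $2$ means $\mathsf{M}$ has rank $n-2$. $Z$-polynomials: there is a unique way to assign to each loopless matroid $\mathsf{M}$ a polynomial $P_{\mathsf{M}}(t)\in\mathbb{Z}[t]$ (the Kazhdan–Lusztig polynomial) such that: (i) if $\operatorname{rk}(\mathsf{M})=0$ then $P_{\mathsf{M}}(t)=1$; (ii) if $\operatorname{rk}(\mathsf{M})>0$ then $\deg P_{\mathsf{M}}<\frac12\operatorname{rk}(\mathsf{M})$; (iii) for every loopless $\mathsf{M}$, the polynomial $Z_{\mathsf{M}}(t)=\sum_{F}t^{\operatorname{rk}(F)}P_{\mathsf{M}/F}(t)$, summed over all flats $F$ of $\mathsf{M}$, is palindromic, i.e. $t^{\operatorname{rk}(\mathsf{M})}Z_{\mathsf{M}}(t^{-1})=Z_{\mathsf{M}}(t)$. $Z_{\mathsf{M}}$ is the $Z$-polynomial of $\mathsf{M}$. Convention: for matroids with loops, $P_{\mathsf{M}}=Z_{\mathsf{M}}=0$. *)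

theory Defs
  imports "HOL-Computational_Algebra.Polynomial"
begin

section \<open>Matroids\<close>

datatype 'a set_system = Set_System (ground: "'a set") (indep: "'a set set")

definition matroid :: "'a set_system \<Rightarrow> bool" where
  "matroid M \<longleftrightarrow>
     finite (ground M) \<and> indep M \<subseteq> Pow (ground M) \<and> {} \<in> indep M \<and>
     (\<forall>I J. J \<in> indep M \<and> I \<subseteq> J \<longrightarrow> I \<in> indep M) \<and>
     (\<forall>I J. I \<in> indep M \<and> J \<in> indep M \<and> card I < card J \<longrightarrow>
        (\<exists>x\<in>J - I. insert x I \<in> indep M))"

definition rk :: "'a set_system \<Rightarrow> 'a set \<Rightarrow> nat" where
  "rk M X = Max (card ` {I \<in> indep M. I \<subseteq> X})"

definition rank :: "'a set_system \<Rightarrow> nat" where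
  "rank M = rk M (ground M)"

(* Truncated subtraction is harmless: rank M <= card (ground M) for a matroid M. *)
definition corank :: "'a set_system \<Rightarrow> nat" where
  "corank M = card (ground M) - rank M"

definition basis_of :: "'a set_system \<Rightarrow> 'a set \<Rightarrow> 'a set \<Rightarrow> bool" where
  "basis_of M X B \<longleftrightarrow>
     B \<in> indep M \<and> B \<subseteq> X \<and> (\<forall>J \<in> indep M. B \<subseteq> J \<and> J \<subseteq> X \<longrightarrow> J = B)"

definition loopless :: "'a set_system \<Rightarrow> bool" where
  "loopless M \<longleftrightarrow> (\<forall>e \<in> ground M. {e} \<in> indep M)"

definition coloopless :: "'a set_system \<Rightarrow> bool" where
  "coloopless M \<longleftrightarrow> (\<forall>e \<in> ground M. \<exists>B. basis_of M (ground M) B \<and> e \<notin> B)"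

definition flats :: "'a set_system \<Rightarrow> 'a set set" where
  "flats M = {F. F \<subseteq> ground M \<and> (\<forall>x \<in> ground M - F. rk M F < rk M (insert x F))}"

definition contract :: "'a set_system \<Rightarrow> 'a set \<Rightarrow> 'a set_system" where
  "contract M X = Set_System (ground M - X)
     {I. I \<subseteq> ground M - X \<and> (\<exists>B. basis_of M X B \<and> I \<union> B \<in> indep M)}"

definition uniform_matroid :: "nat \<Rightarrow> nat \<Rightarrow> nat set_system" where
  "uniform_matroid k n = Set_System {..<n} {I. I \<subseteq> {..<n} \<and> card I \<le> k}"


section \<open>Kazhdan--Lusztig polynomials and Z-polynomials\<close>

(* The identity t^r p(1/t) = p(t) of Laurent polynomials: the left-hand side has the coefficient
   of t^(r-i) in p at t^i for every integer i, whence the degree bound for negative r-i. *)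
definition palindromic :: "nat \<Rightarrow> int poly \<Rightarrow> bool" where
  "palindromic r p \<longleftrightarrow> degree p \<le> r \<and> (\<forall>i\<le>r. coeff p (r - i) = coeff p i)"

definition Z_sum :: "('a set_system \<Rightarrow> int poly) \<Rightarrow> 'a set_system \<Rightarrow> int poly" where
  "Z_sum P M = (\<Sum>F \<in> flats M. monom 1 (rk M F) * P (contract M F))"

(* Contractions stay inside the type 'a set_system, so the family can be taken over all matroids
   on finite subsets of 'a. The first conjunct makes P a function of all set systems
   and contains the convention P = 0 for matroids with loops. *)
definition KL_family :: "('a set_system \<Rightarrow> int poly) \<Rightarrow> bool" where
  "KL_family P \<longleftrightarrow>
     (\<forall>M. \<not> (matroid M \<and> loopless M) \<longrightarrow> P M = 0) \<and>
     (\<forall>M. matroid M \<and> loopless M \<longrightarrow>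
        (rank M = 0 \<longrightarrow> P M = 1) \<and>
        (rank M > 0 \<longrightarrow> 2 * degree (P M) < rank M) \<and>
        palindromic (rank M) (Z_sum P M))"

definition KL_poly :: "'a set_system \<Rightarrow> int poly" where
  "KL_poly = (THE P. KL_family P)"

definition Z_poly :: "'a set_system \<Rightarrow> int poly" where
  "Z_poly M = (if matroid M \<and> loopless M then Z_sum KL_poly M else 0)"


section \<open>Existence and uniqueness of the Kazhdan--Lusztig family\<close>

lemma matroid_indepD:
  assumes "matroid M"
  shows "finite (ground M)" "finite (indep M)" "{} \<in> indep M"
    and "I \<in> indep M \<Longrightarrow> I \<subseteq> ground M" "I \<in> indep M \<Longrightarrow> finite I"
    and "J \<in> indep M \<Longrightarrow> I \<subseteq> J \<Longrightarrow> I \<in> indep M"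
    and "I \<in> indep M \<Longrightarrow> J \<in> indep M \<Longrightarrow> card I < card J \<Longrightarrow> \<exists>x\<in>J - I. insert x I \<in> indep M"
proof -
  show fin: "finite (ground M)" and "{} \<in> indep M"
    using assms by (simp_all add: matroid_def)
  have sub: "indep M \<subseteq> Pow (ground M)" using assms by (simp add: matroid_def)
  then show "finite (indep M)" using fin by (meson finite_Pow_iff finite_subset)
  show "I \<in> indep M \<Longrightarrow> I \<subseteq> ground M" using sub by blast
  then show "I \<in> indep M \<Longrightarrow> finite I" using fin finite_subset by blast
  show "J \<in> indep M \<Longrightarrow> I \<subseteq> J \<Longrightarrow> I \<in> indep M"
    and "I \<in> indep M \<Longrightarrow> J \<in> indep M \<Longrightarrow> card I < card J \<Longrightarrow> \<exists>x\<in>J - I. insert x I \<in> indep M"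
    using assms unfolding matroid_def by blast+
qed

lemma rk_ge:
  assumes "matroid M" "I \<in> indep M" "I \<subseteq> X"
  shows "card I \<le> rk M X"
  unfolding rk_def using assms matroid_indepD(2)[OF assms(1)] by (intro Max_ge) auto

lemma rk_attained:
  assumes "matroid M"
  obtains I where "I \<in> indep M" "I \<subseteq> X" "card I = rk M X"
proof -
  have "rk M X \<in> card ` {I \<in> indep M. I \<subseteq> X}"
    unfolding rk_def using matroid_indepD(2,3)[OF assms] by (intro Max_in) auto
  then show thesis using that by auto
qed

lemma rk_le_card:
  assumes "matroid M" "finite X"
  shows "rk M X \<le> card X"
proof -
  obtain I where "I \<subseteq> X" "card I = rk M X" using rk_attained[OF assms(1)] by metis
  then show ?thesis using card_mono[OF assms(2)] by metis
qed

lemma rk_eq_basis: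
  assumes "matroid M" "basis_of M X B"
  shows "card B = rk M X"
proof (rule ccontr)
  assume ne: "card B \<noteq> rk M X"
  obtain I where I: "I \<in> indep M" "I \<subseteq> X" "card I = rk M X"
    using rk_attained[OF assms(1)] by metis
  have B: "B \<in> indep M" "B \<subseteq> X" using assms(2) by (auto simp: basis_of_def)
  then have "card B < card I" using rk_ge[OF assms(1)] ne I by (metis le_neq_implies_less)
  then obtain x where "x \<in> I - B" "insert x B \<in> indep M"
    using matroid_indepD(7)[OF assms(1)] B I by blast
  then show False using assms(2) I unfolding basis_of_def by blast
qed

lemma basis_exists:
  assumes "matroid M"
  obtains B where "basis_of M X B"
proof -
  obtain I where I: "I \<in> indep M" "I \<subseteq> X" "card I = rk M X"
    using rk_attained[OF assms] by metis
  have "J = I" if "J \<in> indep M" "I \<subseteq> J" "J \<subseteq> X" for J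
    using card_seteq[OF matroid_indepD(5)[OF assms that(1)] that(2)]
      rk_ge[OF assms that(1,3)] I(3) by simp
  then have "basis_of M X I" unfolding basis_of_def using I by blast
  then show thesis using that by blast
qed

lemma matroid_contract:
  assumes M: "matroid M"
  shows "matroid (contract M X)"
proof -
  have bas: "finite B" "B \<subseteq> X" "card B = rk M X" "B \<in> indep M" if "basis_of M X B" for B
    using that matroid_indepD(5)[OF M] rk_eq_basis[OF M] by (auto simp: basis_of_def)
  have aug: "\<exists>x\<in>J - I. insert x I \<in> indep (contract M X)"
    if I: "I \<in> indep (contract M X)" and J: "J \<in> indep (contract M X)" and c: "card I < card J"
    for I J
  proof -
    obtain B where B: "I \<subseteq> ground M - X" "basis_of M X B" "I \<union> B \<in> indep M"
      using I by (auto simp: contract_def)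
    obtain C where C: "J \<subseteq> ground M - X" "basis_of M X C" "J \<union> C \<in> indep M"
      using J by (auto simp: contract_def)
    have fin: "finite I" "finite J"
      using matroid_indepD(5)[OF M B(3)] matroid_indepD(5)[OF M C(3)] by simp_all
    have "card (I \<union> B) = card I + card B" "card (J \<union> C) = card J + card C"
      using B(1) C(1) bas(1,2)[OF B(2)] bas(1,2)[OF C(2)] fin
      by (intro card_Un_disjoint; blast)+
    then have "card (I \<union> B) < card (J \<union> C)"
      using c bas(3)[OF B(2)] bas(3)[OF C(2)] by simp
    then obtain x where x: "x \<in> (J \<union> C) - (I \<union> B)" "insert x (I \<union> B) \<in> indep M"
      using matroid_indepD(7)[OF M B(3) C(3)] by blast
    have "x \<notin> X"
    proof
      assume "x \<in> X"
      moreover have "insert x B \<in> indep M" using matroid_indepD(6)[OF M x(2)] by blast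
      ultimately show False using B(2) x(1) unfolding basis_of_def by blast
    qed
    then have "x \<in> J - I" using x(1) bas(2)[OF C(2)] by blast
    moreover have "insert x I \<in> indep (contract M X)"
      using B x(2) C(1) \<open>x \<in> J - I\<close> by (auto simp: contract_def)
    ultimately show ?thesis by blast
  qed
  obtain B where "basis_of M X B" using basis_exists[OF M] by metis
  then have "{} \<in> indep (contract M X)" using bas(4) by (auto simp: contract_def)
  moreover have down: "I \<in> indep (contract M X)"
    if "J \<in> indep (contract M X)" "I \<subseteq> J" for I J
  proof -
    obtain B where B: "J \<subseteq> ground M - X" "basis_of M X B" "J \<union> B \<in> indep M"
      using \<open>J \<in> indep (contract M X)\<close> by (auto simp: contract_def)
    have "I \<union> B \<in> indep M" using matroid_indepD(6)[OF M B(3)] that(2) by blast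
    then show ?thesis using B that(2) by (auto simp: contract_def)
  qed
  moreover have "finite (ground (contract M X))"
    using matroid_indepD(1)[OF M] by (simp add: contract_def)
  moreover have "indep (contract M X) \<subseteq> Pow (ground (contract M X))"
    by (auto simp: contract_def)
  ultimately show ?thesis unfolding matroid_def using aug
    by (intro conjI allI impI) (simp_all, metis down)
qed

lemma rank_contract:
  assumes M: "matroid M"
  shows "rank (contract M X) + rk M X \<le> rank M"
proof -
  obtain I where I: "I \<in> indep (contract M X)" "card I = rank (contract M X)"
    unfolding rank_def using rk_attained[OF matroid_contract[OF M]] by metis
  then obtain B where B: "I \<subseteq> ground M - X" "basis_of M X B" "I \<union> B \<in> indep M"
    by (auto simp: contract_def)
  have "finite I" "finite B" using matroid_indepD(5)[OF M B(3)] by simp_all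
  moreover have "I \<inter> B = {}" using B(1,2) by (auto simp: basis_of_def)
  ultimately have "card (I \<union> B) = card I + card B" by (rule card_Un_disjoint)
  moreover have "card (I \<union> B) \<le> rank M"
    unfolding rank_def using rk_ge[OF M B(3)] matroid_indepD(4)[OF M B(3)] by blast
  ultimately show ?thesis using I(2) rk_eq_basis[OF M B(2)] by simp
qed

lemma loopless_contract:
  assumes M: "matroid M" and F: "F \<in> flats M"
  shows "loopless (contract M F)"
  unfolding loopless_def
proof
  fix e assume "e \<in> ground (contract M F)"
  then have e: "e \<in> ground M - F" by (simp add: contract_def)
  obtain B where B: "basis_of M F B" using basis_exists[OF M] by metis
  obtain J where J: "J \<in> indep M" "J \<subseteq> insert e F" "card J = rk M (insert e F)"
    using rk_attained[OF M] by metis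
  have "card B < card J"
    using J(3) rk_eq_basis[OF M B] F e by (auto simp: flats_def)
  moreover have "B \<in> indep M" using B by (simp add: basis_of_def)
  ultimately obtain x where x: "x \<in> J - B" "insert x B \<in> indep M"
    using matroid_indepD(7)[OF M _ J(1)] by blast
  have "x \<notin> F" using x B unfolding basis_of_def by blast
  then have "x = e" using x(1) J(2) by blast
  then show "{e} \<in> indep (contract M F)" using x(2) B e by (auto simp: contract_def)
qed

lemma contract_empty:
  assumes "matroid M"
  shows "contract M {} = M"
proof -
  have "basis_of M {} B \<longleftrightarrow> B = {}" for B
    using matroid_indepD(3)[OF assms] by (auto simp: basis_of_def)
  then show ?thesis
    using matroid_indepD(4)[OF assms] by (cases M) (auto simp: contract_def)
qed

lemma rk_empty: "matroid M \<Longrightarrow> rk M {} = 0"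
  using rk_le_card[of M "{}"] by simp

lemma empty_flat:
  assumes M: "matroid M" and L: "loopless M"
  shows "{} \<in> flats M"
proof -
  have "rk M {e} > 0" if "e \<in> ground M" for e
    using rk_ge[OF M, of "{e}" "{e}"] L that by (auto simp: loopless_def)
  then show ?thesis by (simp add: flats_def rk_empty[OF M])
qed

lemma finite_flats:
  assumes "matroid M"
  shows "finite (flats M)"
proof (rule finite_subset)
  show "flats M \<subseteq> Pow (ground M)" by (auto simp: flats_def)
qed (simp add: matroid_indepD(1)[OF assms])

lemma Z_sum_split:
  assumes "matroid M" "loopless M"
  shows "Z_sum P M = P M + (\<Sum>F \<in> flats M - {{}}. monom 1 (rk M F) * P (contract M F))"
  unfolding Z_sum_def
  using sum.remove[OF finite_flats empty_flat, OF assms(1) assms,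
      of "\<lambda>F. monom 1 (rk M F) * P (contract M F)"]
  by (simp add: contract_empty[OF assms(1)] rk_empty[OF assms(1)])

lemma card_contract_less:
  assumes "matroid M" "F \<in> flats M - {{}}"
  shows "card (ground (contract M F)) < card (ground M)"
  using assms matroid_indepD(1)[OF assms(1)]
  by (auto simp: contract_def flats_def intro!: psubset_card_mono)

lemma rank_0_ground:
  assumes "matroid M" "loopless M" "rank M = 0"
  shows "ground M = {}"
proof (rule ccontr)
  assume "ground M \<noteq> {}"
  then obtain e where "e \<in> ground M" by blast
  then have "card {e} \<le> rank M"
    unfolding rank_def using assms(2) by (intro rk_ge[OF assms(1)]) (auto simp: loopless_def)
  then show False using assms(3) by simp
qed

lemma palindromic_unique:
  assumes "palindromic r (p + q)" "palindromic r (p' + q)" "2 * degree p < r" "2 * degree p' < r"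
  shows "p = p'"
proof (rule poly_eqI)
  fix i
  have low: "coeff p i = coeff p' i" if "2 * i < r" for i
  proof -
    have "coeff p (r - i) = 0" "coeff p' (r - i) = 0"
      using that assms(3,4) by (auto intro!: coeff_eq_0)
    moreover have "coeff (p + q) (r - i) = coeff (p + q) i"
      "coeff (p' + q) (r - i) = coeff (p' + q) i"
      using that assms(1,2) by (simp_all add: palindromic_def)
    ultimately show ?thesis by simp
  qed
  show "coeff p i = coeff p' i"
  proof (cases "2 * i < r")
    case False
    then have "coeff p i = 0" "coeff p' i = 0"
      using assms(3,4) by (auto intro!: coeff_eq_0)
    then show ?thesis by simp
  qed (rule low)
qed

lemma matroid_uniform: "matroid (uniform_matroid k n)"
proof -
  have aug: "\<exists>x\<in>J - I. insert x I \<subseteq> {..<n} \<and> card (insert x I) \<le> k"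
    if t: "I \<subseteq> {..<n}" "J \<subseteq> {..<n}" "card J \<le> k" "card I < card J" for I J :: "nat set"
  proof -
    have fin: "finite I" using t(1) finite_subset by blast
    have "\<not> J \<subseteq> I" using t(4) card_mono[OF fin, of J] by linarith
    then obtain x where "x \<in> J - I" by blast
    then show ?thesis using t fin by (intro bexI[of _ x]) auto
  qed
  have down: "I \<subseteq> {..<n} \<and> card I \<le> k"
    if "J \<subseteq> {..<n}" "card J \<le> k" "I \<subseteq> J" for I J :: "nat set"
    using that card_mono[of J I] finite_subset[of J "{..<n}"] by auto
  show ?thesis
    unfolding matroid_def uniform_matroid_def set_system.sel mem_Collect_eq
    by (intro conjI allI impI; (elim conjE)?;
        (rule aug; assumption | blast dest: down | simp))
qed

lemma KL_familyD:
  assumes "KL_family P"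
  shows "\<not> (matroid M \<and> loopless M) \<Longrightarrow> P M = 0"
    and "matroid M \<Longrightarrow> loopless M \<Longrightarrow> rank M = 0 \<Longrightarrow> P M = 1"
    and "matroid M \<Longrightarrow> loopless M \<Longrightarrow> rank M > 0 \<Longrightarrow> 2 * degree (P M) < rank M"
    and "matroid M \<Longrightarrow> loopless M \<Longrightarrow> palindromic (rank M) (Z_sum P M)"
  using assms by (auto simp: KL_family_def)

lemma KL_family_unique:
  assumes P: "KL_family P" and Q: "KL_family Q"
  shows "P = Q"
proof
  fix M :: "'a set_system"
  show "P M = Q M"
  proof (induction "card (ground M)" arbitrary: M rule: less_induct)
    case less
    show ?case
    proof (cases "matroid M \<and> loopless M \<and> rank M > 0")
      case True
      have "(\<Sum>F \<in> flats M - {{}}. monom 1 (rk M F) * P (contract M F)) =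
            (\<Sum>F \<in> flats M - {{}}. monom 1 (rk M F) * Q (contract M F))"
        using less card_contract_less True by (intro sum.cong) auto
      then have "palindromic (rank M) (Q M +
          (\<Sum>F \<in> flats M - {{}}. monom 1 (rk M F) * P (contract M F)))"
        using KL_familyD(4)[OF Q, of M] True Z_sum_split[of M Q] by simp
      moreover have "palindromic (rank M) (P M +
          (\<Sum>F \<in> flats M - {{}}. monom 1 (rk M F) * P (contract M F)))"
        using KL_familyD(4)[OF P, of M] True Z_sum_split[of M P] by simp
      moreover have "2 * degree (P M) < rank M" "2 * degree (Q M) < rank M"
        using KL_familyD(3)[OF P] KL_familyD(3)[OF Q] True by simp_all
      ultimately show ?thesis using palindromic_unique by blast
    next
      case False
      then show ?thesis using KL_familyD(1,2)[OF P] KL_familyD(1,2)[OF Q]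
        by (cases "matroid M \<and> loopless M") auto
    qed
  qed
qed

definition KL_step :: "('a set_system \<Rightarrow> int poly) \<Rightarrow> 'a set_system \<Rightarrow> int poly" where
  "KL_step f M =
     (if \<not> (matroid M \<and> loopless M) then 0 else if rank M = 0 then 1 else
        (let q = (\<Sum>F \<in> flats M - {{}}. monom 1 (rk M F) * f (contract M F))
         in \<Sum>i | 2 * i < rank M. monom (coeff q (rank M - i) - coeff q i) i))"

lemma KL_family_exists: "\<exists>P :: 'a set_system \<Rightarrow> int poly. KL_family P"
proof -
  define R where "R = measure (\<lambda>M :: 'a set_system. card (ground M))"
  define P where "P = wfrec R KL_step"
  have P_eq: "P M = KL_step P M" for M
  proof -
    have "P M = KL_step (cut P R M) M"
      unfolding P_def by (rule wfrec) (simp add: R_def)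
    also have "\<dots> = KL_step P M"
    proof (cases "matroid M")
      case True
      have "(\<Sum>F \<in> flats M - {{}}. monom 1 (rk M F) * cut P R M (contract M F)) =
            (\<Sum>F \<in> flats M - {{}}. monom 1 (rk M F) * P (contract M F))"
        using card_contract_less[OF True] by (intro sum.cong) (auto simp: cut_def R_def)
      then show ?thesis by (simp add: KL_step_def)
    qed (simp add: KL_step_def)
    finally show ?thesis .
  qed
  have zero: "P M = 0" if "\<not> (matroid M \<and> loopless M)" for M
    using that by (subst P_eq) (simp add: KL_step_def)
  have one: "P M = 1" if "matroid M" "loopless M" "rank M = 0" for M
    using that by (subst P_eq) (simp add: KL_step_def)
  have coeffs: "coeff (P M) i = (if 2 * i < rank M then coeff q (rank M - i) - coeff q i else 0)"
    if "matroid M" "loopless M" "rank M > 0"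
      and q: "q = (\<Sum>F \<in> flats M - {{}}. monom 1 (rk M F) * P (contract M F))" for M q i
  proof -
    have fin: "finite {i. 2 * i < rank M}"
      by (rule finite_subset[of _ "{..rank M}"]) auto
    have "P M = (\<Sum>i | 2 * i < rank M. monom (coeff q (rank M - i) - coeff q i) i)"
      using that by (subst P_eq) (simp add: KL_step_def Let_def)
    then show ?thesis using fin by (simp add: coeff_sum sum.delta)
  qed
  have deg: "2 * degree (P M) < rank M" if "matroid M" "loopless M" "rank M > 0" for M
  proof (cases "P M = 0")
    case False
    then have "coeff (P M) (degree (P M)) \<noteq> 0" by simp
    then show ?thesis using coeffs[OF that refl] by (metis (no_types, lifting))
  qed (use that in simp)
  have deg_le: "2 * degree (P M) \<le> rank M" for M
  proof (cases "matroid M \<and> loopless M")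
    case True
    then show ?thesis using one[of M] deg[of M] by (cases "rank M = 0") auto
  qed (simp add: zero)
  have pal: "palindromic (rank M) (Z_sum P M)" if M: "matroid M" "loopless M" for M
  proof (cases "rank M = 0")
    case True
    have "flats M = {{}}"
      using rank_0_ground[OF M True] empty_flat[OF M] by (auto simp: flats_def)
    then have "Z_sum P M = 1" using Z_sum_split[OF M, of P] one[OF M True] by simp
    then show ?thesis using True by (simp add: palindromic_def)
  next
    case False
    then have r: "rank M > 0" by simp
    define q where "q = (\<Sum>F \<in> flats M - {{}}. monom 1 (rk M F) * P (contract M F))"
    have "degree (monom 1 (rk M F) * P (contract M F)) \<le> rank M" for F
    proof -
      have "degree (monom 1 (rk M F) * P (contract M F)) \<le> rk M F + degree (P (contract M F))"
        using degree_mult_le[of "monom 1 (rk M F)" "P (contract M F)"]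
          degree_monom_le[of "1::int" "rk M F"] by linarith
      then show ?thesis
        using deg_le[of "contract M F"] rank_contract[OF M(1), of F] by linarith
    qed
    then have dq: "degree q \<le> rank M" unfolding q_def by (intro degree_sum_le) (auto simp: finite_flats M)
    have Z: "Z_sum P M = P M + q" using Z_sum_split[OF M] by (simp add: q_def)
    have c: "coeff (P M) i = (if 2 * i < rank M then coeff q (rank M - i) - coeff q i else 0)" for i
      by (rule coeffs[OF M r q_def])
    have "coeff (P M + q) (rank M - i) = coeff (P M + q) i" if i: "i \<le> rank M" for i
    proof -
      consider "2 * i < rank M" | "2 * i = rank M" | "2 * i > rank M" by linarith
      then show ?thesis
      proof cases
        case 2
        then have "rank M - i = i" by simp
        then show ?thesis by simp
      qed (use i in \<open>auto simp: c\<close>)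
    qed
    moreover have "degree (P M + q) \<le> rank M"
      using dq deg_le[of M] by (intro degree_add_le) auto
    ultimately show ?thesis by (simp add: Z palindromic_def)
  qed
  have "KL_family P" unfolding KL_family_def using zero one deg pal by blast
  then show ?thesis by blast
qed

theorem KL_family_KL_poly: "KL_family (KL_poly :: 'a set_system \<Rightarrow> int poly)"
proof -
  have "\<exists>!P :: 'a set_system \<Rightarrow> int poly. KL_family P"
    using KL_family_exists KL_family_unique by (rule ex_ex1I)
  then show ?thesis unfolding KL_poly_def by (rule theI')
qed

end

theory Submission
  imports Defs
begin

text \<open>
  The dual of a coloopless matroid of corank 2 is a loopless matroid of rank 2, so it is determined
  by its parallel classes. Write $a_s$ for their sizes, $n$ for their sum, and $N_j$ for the
  $Z$-polynomial of $\mathsf{U}_{j,j+1}$ (a Narayana polynomial). If the matroid is loopless, its $Z$-polynomial is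
  $\sum_s \sum_{j < a_s} N_j N_{n-2-j} - \sum_{j < n-1} N_j N_{n-2-j}$.
  This is additive in the classes because the corresponding formula for the Kazhdan--Lusztig
  polynomials is, and the latter has the right degree term by term.
  Since $N_j N_{n-2-j} \le N_{n-2}$ coefficientwise, with equality for $j = 0$, the maximum is
  attained when all classes are singletons, i.e. for the uniform matroid.
\<close>

section \<open>Coranks and series classes\<close>

text \<open>Contracting \<open>M\<close> deletes elements from the dual, so the remaining elements
  keep their labels and every contraction is described by the complement \<open>G\<close> of a flat
  of \<open>M\<close>. One candidate for the Kazhdan--Lusztig polynomial as a function of
  \<open>G\<close> can thus be verified by induction, through uniqueness, without solving the
  recursion. The obstacle is that \<open>G\<close> may have dual rank r = 0, 1 or 2, and in corank 2
  the flat has rank |E - G| - 2 + r, so the weight in the Z-polynomial is not uniform in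
  \<open>G\<close>. After multiplication by t the extra factor is t^(r-1). For nonempty
  \<open>G\<close> it is absorbed by \<open>shifted_KL\<close>, a single expression made of one term
  per class and terms depending only on |G|; such terms can be summed over all subsets separately.
  The product inequality rests on expanding Narayana polynomials in t^i (1 + t)^(n-2i). Written as
  sums over subsets of an n-element set, both sides can be compared term by term, and C_i C_k <=
  C_(i+k) for Catalan numbers is all that remains.\<close>

lemma basis_extends:
  assumes M: "matroid M" and B: "B \<in> indep M" "B \<subseteq> X"
  obtains J where "basis_of M X J" "B \<subseteq> J"
proof -
  let ?A = "{J \<in> indep M. B \<subseteq> J \<and> J \<subseteq> X}"
  have fin: "finite ?A" using matroid_indepD(2)[OF M] by simp
  have "?A \<noteq> {}" using B by blast
  then obtain J where J: "J \<in> ?A" "\<And>K. K \<in> ?A \<Longrightarrow> J \<subseteq> K \<Longrightarrow> J = K"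
    using finite_has_maximal[OF fin] by auto
  have "basis_of M X J" unfolding basis_of_def using J by blast
  then show thesis using that J by blast
qed

lemma rk_mono:
  assumes "matroid M" "X \<subseteq> Y"
  shows "rk M X \<le> rk M Y"
  by (metis assms rk_attained rk_ge subset_trans)

lemma rk_submodular:
  assumes M: "matroid M"
  shows "rk M (X \<union> Y) + rk M (X \<inter> Y) \<le> rk M X + rk M Y"
proof -
  obtain I where I: "basis_of M (X \<inter> Y) I" using basis_exists[OF M] by metis
  then have "I \<in> indep M" "I \<subseteq> X \<union> Y" by (auto simp: basis_of_def)
  then obtain J where J: "basis_of M (X \<union> Y) J" "I \<subseteq> J" using basis_extends[OF M] by metis
  have JM: "J \<in> indep M" "J \<subseteq> X \<union> Y" using J by (auto simp: basis_of_def)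
  have fin: "finite J" using matroid_indepD(5)[OF M JM(1)] .
  have "J \<inter> X \<in> indep M" "J \<inter> Y \<in> indep M" using matroid_indepD(6)[OF M JM(1)] by auto
  then have *: "card (J \<inter> X) \<le> rk M X" "card (J \<inter> Y) \<le> rk M Y" using rk_ge[OF M] by auto
  have "card (J \<inter> X) + card (J \<inter> Y) = card ((J \<inter> X) \<union> (J \<inter> Y)) + card ((J \<inter> X) \<inter> (J \<inter> Y))"
    by (rule card_Un_Int) (use fin in auto)
  moreover have "(J \<inter> X) \<union> (J \<inter> Y) = J" using JM by blast
  moreover have "card I \<le> card ((J \<inter> X) \<inter> (J \<inter> Y))"
    using I J fin by (intro card_mono) (auto simp: basis_of_def)
  ultimately show ?thesis using * rk_eq_basis[OF M I] rk_eq_basis[OF M J(1)] by simp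
qed

lemma rk_contract:
  assumes M: "matroid M" and X: "X \<subseteq> ground M - F"
  shows "rk (contract M F) X + rk M F = rk M (X \<union> F)"
proof (rule antisym)
  obtain I where I: "I \<in> indep (contract M F)" "I \<subseteq> X" "card I = rk (contract M F) X"
    using rk_attained[OF matroid_contract[OF M]] by metis
  then obtain B where B: "basis_of M F B" "I \<union> B \<in> indep M" "I \<subseteq> ground M - F"
    by (auto simp: contract_def)
  have "card (I \<union> B) = card I + card B"
    using matroid_indepD(5)[OF M B(2)] B by (intro card_Un_disjoint) (auto simp: basis_of_def)
  moreover have "card (I \<union> B) \<le> rk M (X \<union> F)"
    using B I by (intro rk_ge[OF M]) (auto simp: basis_of_def)
  ultimately show "rk (contract M F) X + rk M F \<le> rk M (X \<union> F)"
    using I rk_eq_basis[OF M B(1)] by simp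
next
  obtain B where B: "basis_of M F B" using basis_exists[OF M] by metis
  then have "B \<in> indep M" "B \<subseteq> X \<union> F" by (auto simp: basis_of_def)
  then obtain J where J: "basis_of M (X \<union> F) J" "B \<subseteq> J" using basis_extends[OF M] by metis
  have JM: "J \<in> indep M" "J \<subseteq> X \<union> F" using J by (auto simp: basis_of_def)
  have "J \<inter> F \<in> indep M" using matroid_indepD(6)[OF M JM(1)] by auto
  moreover have "B \<subseteq> J \<inter> F" using B J(2) by (auto simp: basis_of_def)
  ultimately have JF: "J \<inter> F = B" using B by (simp add: basis_of_def)
  then have "J - B \<subseteq> X" "J - B \<subseteq> ground M - F" using JM X by auto
  moreover have "J - B \<union> B = J" using J(2) by blast
  ultimately have "J - B \<subseteq> X" and "J - B \<subseteq> ground M - F \<and> basis_of M F B \<and> J - B \<union> B \<in> indep M"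
    using B JM by simp_all
  then have "J - B \<subseteq> X" "J - B \<in> indep (contract M F)"
    unfolding contract_def set_system.sel by blast+
  then have "card (J - B) \<le> rk (contract M F) X" using rk_ge[OF matroid_contract[OF M]] by simp
  moreover have "card (J - B) + card B = card J"
    using matroid_indepD(5)[OF M JM(1)] J(2)
      card_mono[of J B] finite_subset[of B J] by (simp add: card_Diff_subset)
  ultimately show "rk M (X \<union> F) \<le> rk (contract M F) X + rk M F"
    using rk_eq_basis[OF M J(1)] rk_eq_basis[OF M B] by linarith
qed

text \<open>
  The label of an element is its series class; both sides of the equation minus the rank of $M$ are
  the rank of $G$ in the dual matroid.
\<close>

definition series_labelling :: "('a \<Rightarrow> 'b) \<Rightarrow> 'a set_system \<Rightarrow> bool" where
  "series_labelling k M \<longleftrightarrow> matroid M \<and>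
     (\<forall>G \<subseteq> ground M. card G + rk M (ground M - G) = rank M + min 2 (card (k ` G)))"

text \<open>Passing to the contraction lowers both sides of the equation by \<open>rk M F\<close>.
  The remaining elements may carry a single label or none; contractions of corank 1 and 0 are
  covered in this way.\<close>

lemma series_labelling_contract:
  assumes L: "series_labelling k M" and F: "F \<subseteq> ground M"
  shows "series_labelling k (contract M F)"
  unfolding series_labelling_def
proof (intro conjI allI impI)
  have M: "matroid M" using L by (simp add: series_labelling_def)
  show "matroid (contract M F)" by (rule matroid_contract[OF M])
  fix G assume "G \<subseteq> ground (contract M F)"
  then have G: "G \<subseteq> ground M - F" by (simp add: contract_def)
  have gr: "ground (contract M F) = ground M - F" by (simp add: contract_def)
  have "rk (contract M F) (ground M - F - G) + rk M F = rk M (ground M - F - G \<union> F)"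
    by (rule rk_contract[OF M]) auto
  moreover have "ground M - F - G \<union> F = ground M - G" using F G by auto
  moreover have "rank (contract M F) + rk M F = rank M"
    using rk_contract[OF M, of "ground M - F" F] F by (simp add: rank_def gr Un_absorb1 Un_absorb2)
  moreover have "card G + rk M (ground M - G) = rank M + min 2 (card (k ` G))"
    using L G by (auto simp: series_labelling_def)
  ultimately show "card G + rk (contract M F) (ground (contract M F) - G) =
      rank (contract M F) + min 2 (card (k ` G))" unfolding gr by simp
qed

text \<open>The dual is uniform of rank 2, so no two elements are parallel in it and all labels
  differ.\<close>

lemma series_labelling_uniform:
  assumes "n \<ge> 2"
  shows "series_labelling (\<lambda>x. x) (uniform_matroid (n - 2) n)"
  unfolding series_labelling_def
proof (intro conjI allI impI)
  let ?M = "uniform_matroid (n - 2) n"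
  show M: "matroid ?M" by (rule matroid_uniform)
  have rk: "rk ?M X = min (card X) (n - 2)" if "X \<subseteq> {..<n}" for X
  proof (rule antisym)
    obtain I where I: "I \<in> indep ?M" "I \<subseteq> X" "card I = rk ?M X" using rk_attained[OF M] by metis
    have "finite X" using that finite_subset by blast
    then show "rk ?M X \<le> min (card X) (n - 2)"
      using I card_mono[of X I] by (auto simp: uniform_matroid_def)
    obtain I where "I \<subseteq> X" "card I = min (card X) (n - 2)"
      by (meson min.cobounded1 obtain_subset_with_card_n)
    then show "min (card X) (n - 2) \<le> rk ?M X"
      using that rk_ge[OF M, of I X] by (auto simp: uniform_matroid_def)
  qed
  fix G assume "G \<subseteq> ground ?M"
  then have G: "G \<subseteq> {..<n}" by (simp add: uniform_matroid_def)
  then have "card G \<le> n" "card ({..<n} - G) = n - card G"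
    using card_mono[of "{..<n}" G] by (auto simp: card_Diff_subset finite_subset)
  moreover have "rk ?M (ground ?M - G) = min (card ({..<n} - G)) (n - 2)" "rank ?M = min n (n - 2)"
    using rk[of "{..<n} - G"] rk[of "{..<n}"] by (auto simp: rank_def uniform_matroid_def)
  ultimately show "card G + rk ?M (ground ?M - G) = rank ?M + min 2 (card ((\<lambda>x. x) ` G))"
    using assms by (simp only: image_ident) linarith
qed

text \<open>Being parallel in the dual is an equivalence relation, and an element is labelled by its
  own class, whence the label type \<open>'a set\<close>.\<close>

lemma series_labelling_exists:
  fixes M :: "'a set_system"
  assumes M: "matroid M" and "coloopless M" and "corank M = 2"
  shows "\<exists>k :: 'a \<Rightarrow> 'a set. series_labelling k M"
proof -
  define E where "E = ground M"
  have fin: "finite E" using matroid_indepD(1)[OF M] by (simp add: E_def)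
  \<comment> \<open>The rank function of the dual, integer-valued so that the subtraction does not
    truncate.\<close>
  define c where "c G = int (card G) + int (rk M (E - G)) - int (rank M)" for G
  have rk_E: "rank M = rk M E" by (simp add: rank_def E_def)
  have c_E: "c E = 2"
  proof -
    have "rank M \<le> card E" unfolding rk_E using rk_le_card[OF M fin] .
    then show ?thesis using assms(3) rk_empty[OF M] by (simp add: c_def corank_def E_def)
  qed
  have c_0: "c {} = 0" by (simp add: c_def rk_E)
  have sub: "c (G \<union> H) + c (G \<inter> H) \<le> c G + c H" if "G \<subseteq> E" "H \<subseteq> E" for G H
  proof -
    have "card (G \<union> H) + card (G \<inter> H) = card G + card H"
      using that fin by (metis card_Un_Int finite_subset)
    moreover have "(E - G) \<union> (E - H) = E - (G \<inter> H)" "(E - G) \<inter> (E - H) = E - (G \<union> H)" by auto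
    then have "rk M (E - (G \<inter> H)) + rk M (E - (G \<union> H)) \<le> rk M (E - G) + rk M (E - H)"
      using rk_submodular[OF M, of "E - G" "E - H"] by simp
    ultimately show ?thesis unfolding c_def by linarith
  qed
  have mono: "c G \<le> c H" if "G \<subseteq> H" "H \<subseteq> E" for G H
  proof -
    have "(E - H) \<union> (H - G) = E - G" "(E - H) \<inter> (H - G) = {}" using that by auto
    then have "rk M (E - G) \<le> rk M (E - H) + rk M (H - G)"
      using rk_submodular[OF M, of "E - H" "H - G"] by simp
    moreover have f: "finite H" using finite_subset[OF that(2) fin] .
    then have "rk M (H - G) \<le> card (H - G)" by (intro rk_le_card[OF M]) simp
    moreover have "card (H - G) + card G = card H"
      using that(1) f finite_subset[OF that(1) f] by (simp add: card_Diff_subset card_mono)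
    ultimately show ?thesis unfolding c_def by linarith
  qed
  have sing: "c {e} = 1" if e: "e \<in> E" for e
  proof -
    obtain B where B: "basis_of M E B" "e \<notin> B"
      using \<open>coloopless M\<close> e unfolding coloopless_def E_def by blast
    have "card B \<le> rk M (E - {e})" using B by (intro rk_ge[OF M]) (auto simp: basis_of_def)
    moreover have "rk M (E - {e}) \<le> rk M E" by (rule rk_mono[OF M]) auto
    ultimately show ?thesis using rk_eq_basis[OF M B(1)] by (simp add: c_def rk_E)
  qed
  have ge1: "c G \<ge> 1" if G: "G \<subseteq> E" "G \<noteq> {}" for G
  proof -
    obtain e where "e \<in> G" using G by blast
    then show ?thesis using mono[of "{e}" G] sing[of e] G by (simp add: subset_iff)
  qed
  \<comment> \<open>Submodularity bounds the union by 1 because the intersection already has dual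
    rank 1. Applied to two pairs with a common element, this is transitivity of parallelism.\<close>
  have union: "c (G \<union> H) \<le> 1" if "G \<subseteq> E" "H \<subseteq> E" "G \<inter> H \<noteq> {}" "c G \<le> 1" "c H \<le> 1" for G H
  proof -
    have "c (G \<inter> H) \<ge> 1" using that by (intro ge1) auto
    then show ?thesis using sub[OF that(1,2)] that(4,5) by linarith
  qed
  define k where "k x = {y \<in> E. c {x, y} \<le> 1}" for x
  have k_eq: "k x = k y \<longleftrightarrow> c {x, y} \<le> 1" if "x \<in> E" "y \<in> E" for x y
  proof
    assume "k x = k y"
    then have "y \<in> k x" using sing[of y] that(2) by (simp add: k_def)
    then show "c {x, y} \<le> 1" by (simp add: k_def)
  next
    have aux: "c {y, z} \<le> 1"
      if h: "c {x, y} \<le> 1" "c {x, z} \<le> 1" "x \<in> E" "y \<in> E" "z \<in> E" for x y z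
    proof -
      have "c ({x, y} \<union> {x, z}) \<le> 1" by (rule union) (use h in simp_all)
      moreover have "c {y, z} \<le> c ({x, y} \<union> {x, z})" by (rule mono) (use h in simp_all)
      ultimately show ?thesis by linarith
    qed
    assume xy: "c {x, y} \<le> 1"
    then have yx: "c {y, x} \<le> 1" by (simp add: insert_commute)
    show "k x = k y" unfolding k_def using aux[OF xy _ that] aux[OF yx _ that(2,1)] by blast
  qed
  \<comment> \<open>Pairwise parallel to \<open>x\<close> suffices: elements are added one at a
    time, and \<open>x\<close> lies in both sets to which \<open>union\<close> is applied.\<close>
  have one: "c G \<le> 1" if "G \<subseteq> E" "x \<in> G" and pair: "\<And>y. y \<in> G \<Longrightarrow> c {x, y} \<le> 1" for G x
  proof -
    have "finite G" using that(1) fin finite_subset by blast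
    have "c (insert x H) \<le> 1" if "finite H" "H \<subseteq> G" for H
      using that
    proof (induction H rule: finite_induct)
      case empty
      then show ?case using sing[of x] \<open>x \<in> G\<close> \<open>G \<subseteq> E\<close> by (simp add: subset_iff)
    next
      case (insert y H)
      have "insert x H \<union> {x, y} = insert x (insert y H)" by auto
      moreover have "c (insert x H \<union> {x, y}) \<le> 1"
      proof (rule union)
        show "c {x, y} \<le> 1" using insert.prems pair by simp
        show "c (insert x H) \<le> 1" using insert.IH insert.prems by simp
      qed (use insert.prems \<open>x \<in> G\<close> \<open>G \<subseteq> E\<close> in blast)+
      ultimately show ?case by simp
    qed
    from this[of G] show ?thesis using \<open>finite G\<close> \<open>x \<in> G\<close> by (simp add: insert_absorb)
  qed
  have "c G = int (min 2 (card (k ` G)))" if G: "G \<subseteq> E" for G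
  proof -
    have fG: "finite G" using G fin finite_subset by blast
    consider "G = {}" | x where "x \<in> G" "\<forall>y \<in> G. k x = k y"
      | x y where "x \<in> G" "y \<in> G" "k x \<noteq> k y"
      by (metis all_not_in_conv)
    then show ?thesis
    proof cases
      case (2 x)
      have "c {x, y} \<le> 1" if "y \<in> G" for y
      proof -
        have "x \<in> E" "y \<in> E" "k x = k y" using 2 G that by blast+
        then show ?thesis using k_eq[of x y] by simp
      qed
      then have "c G \<le> 1" using one[OF G 2(1)] by simp
      moreover have "c G \<ge> 1" using 2(1) by (intro ge1[OF G]) blast
      moreover have "k ` G = {k x}" using 2 by blast
      ultimately show ?thesis by simp
    next
      case (3 x y)
      then have "x \<in> E" "y \<in> E" using G by blast+
      then have "c {x, y} > 1" using k_eq[of x y] 3 by simp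
      then have "c G > 1" using mono[of "{x, y}" G] 3 G by simp
      moreover have "c G \<le> 2" using mono[of G E] G c_E by simp
      moreover have "card {k x, k y} \<le> card (k ` G)" using 3 fG by (intro card_mono) simp_all
      then have "card (k ` G) \<ge> 2" using 3 by simp
      ultimately show ?thesis by simp
    qed (simp add: c_0)
  qed
  then have "card G + rk M (ground M - G) = rank M + min 2 (card (k ` G))" if "G \<subseteq> ground M" for G
  proof -
    have "int (card G) + int (rk M (ground M - G)) - int (rank M) = int (min 2 (card (k ` G)))"
      using \<open>\<And>G. G \<subseteq> E \<Longrightarrow> c G = int (min 2 (card (k ` G)))\<close>[of G] that by (simp only: c_def E_def)
    then show ?thesis by linarith
  qed
  then have "series_labelling k M" unfolding series_labelling_def using M by simp
  then show ?thesis using exI[of "\<lambda>k. series_labelling k M" k] by simp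
qed

section \<open>Sums over subsets\<close>

lemma sum_Pow_insert:
  assumes "finite X" "e \<notin> X"
  shows "(\<Sum>G\<in>Pow (insert e X). f G) = (\<Sum>G\<in>Pow X. f G) + (\<Sum>G\<in>Pow X. f (insert e G))"
proof -
  have "inj_on (insert e) (Pow X)" using assms(2) by (intro inj_onI) (auto simp: insert_eq_iff)
  moreover have "Pow X \<inter> insert e ` Pow X = {}" using assms(2) by auto
  ultimately show ?thesis using assms(1)
    by (simp add: Pow_insert sum.union_disjoint sum.reindex)
qed

lemma sum_Pow_Un:
  fixes f :: "'a set \<Rightarrow> 'b :: comm_monoid_add"
  assumes "finite X" "finite Y" "X \<inter> Y = {}"
  shows "(\<Sum>G\<in>Pow (X \<union> Y). f G) = (\<Sum>C\<in>Pow X. \<Sum>D\<in>Pow Y. f (C \<union> D))"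
  using assms
proof (induction X arbitrary: f rule: finite_induct)
  case (insert e X)
  have "(\<Sum>G\<in>Pow (insert e (X \<union> Y)). f G) =
      (\<Sum>G\<in>Pow (X \<union> Y). f G) + (\<Sum>G\<in>Pow (X \<union> Y). f (insert e G))"
    using insert by (intro sum_Pow_insert) auto
  then show ?case using insert by (simp add: sum_Pow_insert)
qed simp

lemma sum_Pow_card_cong:
  assumes "finite X" "finite Y" "card X = card Y"
  shows "(\<Sum>G\<in>Pow X. f (card G)) = (\<Sum>G\<in>Pow Y. f (card G))"
proof -
  obtain h where h: "bij_betw h X Y" using assms finite_same_card_bij by blast
  then have "bij_betw ((`) h) (Pow X) (Pow Y)" by (rule bij_betw_Pow)
  then have "(\<Sum>G\<in>Pow Y. f (card G)) = (\<Sum>G\<in>Pow X. f (card (h ` G)))"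
    using sum.reindex_bij_betw[of "(`) h" "Pow X" "Pow Y" "\<lambda>G. f (card G)"] by simp
  also have "\<dots> = (\<Sum>G\<in>Pow X. f (card G))"
    using h by (intro sum.cong refl arg_cong[where f = f] card_image)
      (auto simp: bij_betw_def intro: inj_on_subset)
  finally show ?thesis by simp
qed

lemma sum_Pow_card:
  fixes X :: "'a set"
  assumes "finite X"
  shows "(\<Sum>G\<in>Pow X. f (card G)) = (\<Sum>G\<in>Pow {..<card X}. f (card G))"
  using assms by (intro sum_Pow_card_cong) auto

section \<open>Subset sums weighted by the size of the complement\<close>

text \<open>The shape of a Z-polynomial as a sum over the complements \<open>G\<close> of flats,
  with the cardinality of the flat in place of its rank.\<close>

definition twist :: "'a set \<Rightarrow> ('a set \<Rightarrow> int poly) \<Rightarrow> int poly" where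
  "twist X f = (\<Sum>G\<in>Pow X. monom 1 (card (X - G)) * f G)"

lemma twist_empty [simp]: "twist {} f = f {}"
  by (simp add: twist_def)

lemma twist_cong:
  "X = Y \<Longrightarrow> (\<And>G. G \<subseteq> Y \<Longrightarrow> f G = g G) \<Longrightarrow> twist X f = twist Y g"
  unfolding twist_def by (intro sum.cong) auto

lemma twist_add: "twist X (\<lambda>G. f G + g G) = twist X f + twist X g"
  by (simp add: twist_def distrib_left sum.distrib)

lemma twist_diff: "twist X (\<lambda>G. f G - g G) = twist X f - twist X g"
  by (simp add: twist_def right_diff_distrib sum_subtractf)

lemma twist_mult: "twist X (\<lambda>G. p * f G) = p * twist X f"
  by (simp add: twist_def sum_distrib_left mult.left_commute)

lemma twist_zero [simp]: "twist X (\<lambda>G. 0) = 0"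
  by (simp add: twist_def)

lemma twist_sum: "twist X (\<lambda>G. \<Sum>a\<in>A. f a G) = (\<Sum>a\<in>A. twist X (f a))"
  by (induction A rule: infinite_finite_induct) (simp_all add: twist_add)

lemma twist_insert:
  assumes "finite X" "e \<notin> X"
  shows "twist (insert e X) f = monom 1 1 * twist X f + twist X (\<lambda>G. f (insert e G))"
proof -
  have *: "card (insert e X - G) = Suc (card (X - G))" "insert e X - insert e G = X - G"
    if "G \<in> Pow X" for G
    using that assms by (auto simp: insert_Diff_if)
  have "(\<Sum>G\<in>Pow X. monom 1 (card (insert e X - G)) * f G) = monom 1 1 * twist X f"
    unfolding twist_def sum_distrib_left
    by (intro sum.cong refl) (simp only: *, simp add: mult_monom flip: mult.assoc)
  moreover have "(\<Sum>G\<in>Pow X. monom 1 (card (insert e X - insert e G)) * f (insert e G)) =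
      twist X (\<lambda>G. f (insert e G))"
    unfolding twist_def by (intro sum.cong refl) (simp only: *)
  ultimately show ?thesis by (simp add: twist_def sum_Pow_insert[OF assms])
qed

lemma twist_card_eq:
  assumes "finite X"
  shows "twist X (\<lambda>G. f (card G)) = (\<Sum>G\<in>Pow X. monom 1 (card X - card G) * f (card G))"
proof -
  have "card (X - G) = card X - card G" if "G \<in> Pow X" for G
    using that assms by (simp add: card_Diff_subset finite_subset)
  then show ?thesis unfolding twist_def by (intro sum.cong refl) (simp only:)
qed

lemma twist_Un:
  assumes "finite X" "finite Y" "X \<inter> Y = {}"
  shows "twist (X \<union> Y) (\<lambda>G. f (G \<inter> X) * g (G \<inter> Y)) = twist X f * twist Y g"
proof -
  have "monom 1 (card (X \<union> Y - (C \<union> D))) * (f ((C \<union> D) \<inter> X) * g ((C \<union> D) \<inter> Y)) =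
      (monom 1 (card (X - C)) * f C) * (monom 1 (card (Y - D)) * g D)"
    if "C \<in> Pow X" "D \<in> Pow Y" for C D
  proof -
    have "X \<union> Y - (C \<union> D) = (X - C) \<union> (Y - D)" using that assms by auto
    then have "card (X \<union> Y - (C \<union> D)) = card (X - C) + card (Y - D)"
      using assms by (simp only:, intro card_Un_disjoint) auto
    moreover have "(C \<union> D) \<inter> X = C" "(C \<union> D) \<inter> Y = D" using that assms by auto
    moreover have "monom 1 (a + b) = monom 1 a * (monom 1 b :: int poly)" for a b
      by (simp add: mult_monom)
    ultimately show ?thesis by (simp only: ac_simps)
  qed
  then show ?thesis unfolding twist_def sum_Pow_Un[OF assms] sum_product
    by (intro sum.cong refl) simp
qed

text \<open>For fixed \<open>K\<close>, the weights t^|X - G| of all \<open>G\<close> between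
  \<open>K\<close> and \<open>X\<close> add up to a power of 1 + t.\<close>

lemma twist_sum_Pow:
  assumes "finite X"
  shows "twist X (\<lambda>G. \<Sum>K\<in>Pow G. f K) = (\<Sum>K\<in>Pow X. f K * [:1, 1:] ^ card (X - K))"
  using assms
proof (induction X arbitrary: f rule: finite_induct)
  case (insert e X)
  have fin: "finite G" "e \<notin> G" if "G \<subseteq> X" for G
    using that insert finite_subset by auto
  have *: "card (insert e X - G) = Suc (card (X - G))" "insert e X - insert e G = X - G"
    if "G \<in> Pow X" for G
    using that insert by (auto simp: insert_Diff_if)
  have "twist (insert e X) (\<lambda>G. \<Sum>K\<in>Pow G. f K) =
      monom 1 1 * twist X (\<lambda>G. \<Sum>K\<in>Pow G. f K) +
      twist X (\<lambda>G. (\<Sum>K\<in>Pow G. f K) + (\<Sum>K\<in>Pow G. f (insert e K)))"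
    unfolding twist_insert[OF insert(1,2)]
    by (intro arg_cong2[where f = "(+)"] twist_cong refl) (rule sum_Pow_insert[OF fin])
  also have "\<dots> = [:1, 1:] * (\<Sum>K\<in>Pow X. f K * [:1, 1:] ^ card (X - K)) +
      (\<Sum>K\<in>Pow X. f (insert e K) * [:1, 1:] ^ card (X - K))"
    unfolding twist_add insert.IH by (simp add: monom_altdef algebra_simps)
  also have "\<dots> = (\<Sum>K\<in>Pow (insert e X). f K * [:1, 1:] ^ card (insert e X - K))"
    unfolding sum_Pow_insert[OF insert(1,2)] sum_distrib_left
    by (intro arg_cong2[where f = "(+)"] sum.cong refl)
      (simp_all only: * power_Suc mult.left_commute)
  finally show ?case .
qed simp

section \<open>Palindromic polynomials\<close>

lemma palindromic_add:
  "palindromic r p \<Longrightarrow> palindromic r q \<Longrightarrow> palindromic r (p + q)"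
  by (auto simp: palindromic_def intro: degree_add_le)

lemma palindromic_diff:
  "palindromic r p \<Longrightarrow> palindromic r q \<Longrightarrow> palindromic r (p - q)"
  by (auto simp: palindromic_def intro: degree_diff_le)

lemma palindromic_sum:
  "(\<And>x. x \<in> A \<Longrightarrow> palindromic r (f x)) \<Longrightarrow> palindromic r (\<Sum>x\<in>A. f x)"
proof (induction A rule: infinite_finite_induct)
  case (insert x A)
  then show ?case by (simp add: palindromic_add)
qed (simp_all add: palindromic_def)

text \<open>In this form palindromicity is visibly multiplicative, since \<open>reflect_poly\<close>
  is; the monomial makes up for a degree below \<open>r\<close>.\<close>

lemma palindromic_reflect_poly:
  "palindromic r p \<longleftrightarrow> degree p \<le> r \<and> monom 1 (r - degree p) * reflect_poly p = p"
proof (cases "degree p \<le> r")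
  case True
  define q where "q = monom 1 (r - degree p) * reflect_poly p"
  have c: "coeff q i = (if i \<le> r then coeff p (r - i) else 0)" for i
  proof -
    consider "i < r - degree p" | "r - degree p \<le> i" "i \<le> r" | "i > r" using True by linarith
    then show ?thesis
    proof cases
      case 1
      then have "coeff p (r - i) = 0" by (intro coeff_eq_0) simp
      then show ?thesis using 1 by (simp add: q_def coeff_monom_mult)
    next
      case 2
      then have "degree p - (i - (r - degree p)) = r - i" using True by simp
      then show ?thesis using 2 True by (simp add: q_def coeff_monom_mult coeff_reflect_poly)
    next
      case 3
      then show ?thesis using True by (simp add: q_def coeff_monom_mult coeff_reflect_poly)
    qed
  qed
  have z: "coeff p i = 0" if "\<not> i \<le> r" for i using that True by (intro coeff_eq_0) simp
  have "q = p \<longleftrightarrow> (\<forall>i. coeff q i = coeff p i)" by (rule poly_eq_iff)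
  also have "\<dots> \<longleftrightarrow> (\<forall>i\<le>r. coeff p (r - i) = coeff p i)"
    unfolding c using z by metis
  finally show ?thesis using True by (simp add: palindromic_def q_def)
qed (simp add: palindromic_def)

lemma palindromic_mult:
  assumes "palindromic r p" "palindromic s q"
  shows "palindromic (r + s) (p * q)"
proof (cases "p = 0 \<or> q = 0")
  case True
  then show ?thesis by (auto simp: palindromic_def)
next
  case False
  have p: "degree p \<le> r" "monom 1 (r - degree p) * reflect_poly p = p"
    and q: "degree q \<le> s" "monom 1 (s - degree q) * reflect_poly q = q"
    using assms by (simp_all add: palindromic_reflect_poly)
  have "r + s - (degree p + degree q) = (r - degree p) + (s - degree q)" using p q by simp
  then have "monom 1 (r + s - (degree p + degree q)) * (reflect_poly p * reflect_poly q) =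
      (monom 1 (r - degree p) * reflect_poly p) * (monom 1 (s - degree q) * reflect_poly q)"
    by (simp add: mult_monom ac_simps flip: mult.assoc[of "monom _ _"])
  then show ?thesis using False p q
    by (simp add: palindromic_reflect_poly degree_mult_eq reflect_poly_mult)
qed

lemma palindromic_one_plus_power: "palindromic m ([:1, 1:] ^ m)"
proof (induction m)
  case (Suc m)
  have "palindromic 1 [:1, 1:]"
    by (auto simp: palindromic_def coeff_pCons le_Suc_eq split: nat.split)
  then show ?case using palindromic_mult[OF _ Suc, of 1 "[:1, 1:]"] by simp
qed (simp add: palindromic_def)

lemma palindromic_monom: "palindromic (2 * m) (monom c m)"
  by (auto simp: palindromic_def degree_monom_eq intro: order.trans[OF degree_monom_le])

section \<open>Corank one\<close>

definition catalan :: "nat \<Rightarrow> int" where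
  "catalan i = int ((2 * i) choose i) - int ((2 * i) choose Suc i)"

lemma catalan_binomial: "(int i + 1) * catalan i = int ((2 * i) choose i)"
proof -
  have "Suc i * ((2 * i) choose Suc i) = i * ((2 * i) choose i)"
    using binomial_absorb_comp[of "2 * i" i] binomial_absorption[of i "2 * i"] by (cases "i = 0") simp_all
  then have "int (Suc i) * int ((2 * i) choose Suc i) = int i * int ((2 * i) choose i)"
    by (simp only: flip: of_nat_mult)
  then show ?thesis by (simp add: catalan_def algebra_simps)
qed

lemma catalan_Suc: "(int i + 2) * catalan (Suc i) = (4 * int i + 2) * catalan i"
proof -
  define a c d where "a = (2 * i + 1) choose i" and "c = (2 * i) choose i"
    and "d = (2 * Suc i) choose Suc i"
  have "Suc i * a = (2 * i + 1) * c"
    using binomial_absorb_comp[of "2 * i + 1" i] by (simp add: a_def c_def)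
  then have "int (Suc i * a) = int ((2 * i + 1) * c)" by (rule arg_cong)
  then have 1: "(int i + 1) * int a = (2 * int i + 1) * int c" by (simp add: algebra_simps)
  have "2 * Suc i * a = d * Suc i"
    using Suc_times_binomial_eq[of "2 * i + 1" i] by (simp add: a_def d_def)
  then have "int (2 * Suc i * a) = int (d * Suc i)" by (rule arg_cong)
  then have 2: "2 * ((int i + 1) * int a) = (int i + 1) * int d" by (simp add: algebra_simps)
  have "(int i + 2) * catalan (Suc i) = int d" "(int i + 1) * catalan i = int c"
    using catalan_binomial[of "Suc i"] catalan_binomial[of i]
    unfolding c_def d_def of_nat_Suc by (simp_all only: ac_simps flip: one_add_one)
  then have "(int i + 1) * ((int i + 2) * catalan (Suc i)) = 2 * ((2 * int i + 1) * ((int i + 1) * catalan i))"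
    using 1 2 by metis
  also have "\<dots> = (int i + 1) * ((4 * int i + 2) * catalan i)" by (simp add: algebra_simps)
  finally show ?thesis by (simp add: mult_cancel_left del: distrib_left_numeral)
qed

lemma catalan_nonneg: "catalan i \<ge> 0"
proof -
  have "(int i + 1) * catalan i \<ge> 0" by (simp add: catalan_binomial)
  then show ?thesis by (rule mult_left_le_imp_le[of "int i + 1" 0, simplified])
qed

text \<open>The ratio (4k + 2)/(k + 2) of consecutive Catalan numbers increases with k, so each step
  of the induction enlarges the right-hand side by at least the factor of the left-hand side. The
  computation is multiplied by both denominators.\<close>

lemma catalan_mult_le: "catalan i * catalan k \<le> catalan (i + k)"
proof (induction k)
  case (Suc k)
  let ?i = "int i" and ?k = "int k"
  have "((?k + 2) * (?i + ?k + 2)) * (catalan i * catalan (Suc k)) =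
      (?i + ?k + 2) * catalan i * ((?k + 2) * catalan (Suc k))" by simp
  also have "\<dots> = ((4 * ?k + 2) * (?i + ?k + 2)) * (catalan i * catalan k)"
    unfolding catalan_Suc by simp
  also have "\<dots> \<le> ((4 * (?i + ?k) + 2) * (?k + 2)) * catalan (i + k)"
  proof (rule mult_mono)
    show "(4 * ?k + 2) * (?i + ?k + 2) \<le> (4 * (?i + ?k) + 2) * (?k + 2)" by (simp add: algebra_simps)
  qed (use Suc catalan_nonneg in simp_all)
  also have "\<dots> = (?k + 2) * ((int (i + k) + 2) * catalan (Suc (i + k)))"
    unfolding catalan_Suc by simp
  also have "\<dots> = ((?k + 2) * (?i + ?k + 2)) * catalan (i + Suc k)" by simp
  finally show ?case by (rule mult_left_le_imp_le) simp
qed (simp add: catalan_def)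

section \<open>Motzkin and Narayana polynomials\<close>

text \<open>The value 0 at odd sizes lets sums over all subsets replace sums over subsets of even
  size.\<close>

definition catalan_monom :: "nat \<Rightarrow> int poly" where
  "catalan_monom k = (if even k then monom (catalan (k div 2)) (k div 2) else 0)"

definition motzkin :: "nat \<Rightarrow> int poly" where
  "motzkin n = (\<Sum>K\<in>Pow {..<n}. catalan_monom (card K))"

text \<open>The coefficient of t^i is the Narayana number (n+1 choose i)(n+1 choose i+1)/(n+1). This
  expansion exhibits the palindromicity, and replacing 1 + t by 1 turns it into
  \<open>motzkin n\<close>.\<close>

definition narayana :: "nat \<Rightarrow> int poly" where
  "narayana n = (\<Sum>K\<in>Pow {..<n}. catalan_monom (card K) * [:1, 1:] ^ (n - card K))"

lemma coeff_catalan_monom: "coeff (catalan_monom k) i = (if k = 2 * i then catalan i else 0)"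
  by (auto simp: catalan_monom_def)

lemma coeff_motzkin: "coeff (motzkin n) i = int (n choose (2 * i)) * catalan i"
proof -
  have "coeff (motzkin n) i = (\<Sum>K\<in>Pow {..<n}. if card K = 2 * i then catalan i else 0)"
    by (simp add: motzkin_def coeff_sum coeff_catalan_monom)
  also have "\<dots> = (\<Sum>K\<in>{K \<in> Pow {..<n}. card K = 2 * i}. catalan i)"
    by (rule sum.inter_filter[symmetric]) simp
  also have "\<dots> = int (card {K. K \<subseteq> {..<n} \<and> card K = 2 * i}) * catalan i"
    by (simp add: Pow_def)
  also have "card {K. K \<subseteq> {..<n} \<and> card K = 2 * i} = n choose (2 * i)"
    using n_subsets[of "{..<n}" "2 * i"] by simp
  finally show ?thesis .
qed

lemma narayana_eq:
  assumes "finite X"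
  shows "narayana (card X) = (\<Sum>K\<in>Pow X. catalan_monom (card K) * [:1, 1:] ^ (card X - card K))"
  unfolding narayana_def
  using sum_Pow_card[OF assms, of "\<lambda>g. catalan_monom g * [:1, 1:] ^ (card X - g)"] by simp

lemma twist_motzkin:
  assumes "finite X"
  shows "twist X (\<lambda>G. motzkin (card G)) = narayana (card X)"
proof -
  have "motzkin (card G) = (\<Sum>K\<in>Pow G. catalan_monom (card K))" if "G \<subseteq> X" for G
    unfolding motzkin_def using sum_Pow_card[of G catalan_monom] that assms finite_subset[of G X] by simp
  then have "twist X (\<lambda>G. motzkin (card G)) = twist X (\<lambda>G. \<Sum>K\<in>Pow G. catalan_monom (card K))"
    by (intro twist_cong refl)
  also have "\<dots> = (\<Sum>K\<in>Pow X. catalan_monom (card K) * [:1, 1:] ^ card (X - K))"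
    by (rule twist_sum_Pow[OF assms])
  also have "\<dots> = narayana (card X)"
    unfolding narayana_eq[OF assms]
  proof (intro sum.cong refl)
    fix K assume "K \<in> Pow X"
    then have "card (X - K) = card X - card K" using assms by (simp add: card_Diff_subset finite_subset)
    then show "catalan_monom (card K) * [:1, 1:] ^ card (X - K) = catalan_monom (card K) * [:1, 1:] ^ (card X - card K)"
      by simp
  qed
  finally show ?thesis .
qed

lemma palindromic_narayana: "palindromic n (narayana n)"
  unfolding narayana_def
proof (rule palindromic_sum)
  fix K assume "K \<in> Pow {..<n}"
  then have le: "card K \<le> n" using card_mono[of "{..<n}" K] by simp
  show "palindromic n (catalan_monom (card K) * [:1, 1:] ^ (n - card K))"
  proof (cases "even (card K)")
    case True
    have "palindromic (card K) (catalan_monom (card K))"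
      using palindromic_monom[of "card K div 2"] True by (simp add: catalan_monom_def)
    from palindromic_mult[OF this palindromic_one_plus_power[of "n - card K"]] show ?thesis
      using le by simp
  qed (simp add: catalan_monom_def palindromic_def)
qed

section \<open>Coefficientwise order and products of Narayana polynomials\<close>

definition coeff_le :: "int poly \<Rightarrow> int poly \<Rightarrow> bool" where
  "coeff_le p q \<longleftrightarrow> (\<forall>i. coeff p i \<le> coeff q i)"

lemma coeff_le_refl: "coeff_le p p"
  by (simp add: coeff_le_def)

lemma coeff_le_sum: "(\<And>x. x \<in> A \<Longrightarrow> coeff_le (f x) (g x)) \<Longrightarrow> coeff_le (sum f A) (sum g A)"
  by (simp add: coeff_le_def coeff_sum sum_mono)

lemma coeff_le_mult:
  assumes "coeff_le p q" "coeff_le 0 r"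
  shows "coeff_le (p * r) (q * r)"
  using assms by (auto simp: coeff_le_def coeff_mult intro!: sum_mono mult_right_mono)

lemma coeff_nonneg_mult: "coeff_le 0 p \<Longrightarrow> coeff_le 0 q \<Longrightarrow> coeff_le 0 (p * q)"
  using coeff_le_mult[of 0 p q] by simp

lemma coeff_nonneg_catalan_monom: "coeff_le 0 (catalan_monom k)"
  by (simp add: coeff_le_def coeff_catalan_monom catalan_nonneg)

lemma coeff_nonneg_one_plus_power: "coeff_le 0 ([:1, 1:] ^ m)"
proof (induction m)
  case (Suc m)
  have "coeff_le 0 [:1, 1:]" by (simp add: coeff_le_def coeff_pCons split: nat.split)
  from coeff_nonneg_mult[OF this Suc] show ?case by simp
qed (simp add: coeff_le_def)

lemma coeff_nonneg_narayana: "coeff_le 0 (narayana n)"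
  using coeff_le_sum[of "Pow {..<n}" "\<lambda>K. 0"]
  by (simp add: narayana_def coeff_nonneg_mult coeff_nonneg_catalan_monom coeff_nonneg_one_plus_power)

lemma catalan_monom_mult_le: "coeff_le (catalan_monom a * catalan_monom b) (catalan_monom (a + b))"
proof (cases "even a \<and> even b")
  case True
  then have "catalan_monom a * catalan_monom b = monom (catalan (a div 2) * catalan (b div 2)) ((a + b) div 2)"
    and "catalan_monom (a + b) = monom (catalan (a div 2 + b div 2)) ((a + b) div 2)"
    by (auto simp: catalan_monom_def mult_monom elim!: evenE)
  then show ?thesis using catalan_mult_le by (simp add: coeff_le_def)
next
  case False
  then have "catalan_monom a * catalan_monom b = 0" by (auto simp: catalan_monom_def)
  then show ?thesis using coeff_nonneg_catalan_monom by (simp only:)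
qed

text \<open>Subsets of a disjoint union are pairs (C, D), and the powers of 1 + t agree for each
  pair, so only the Catalan factors are compared. If |C| or |D| is odd, the left term is 0 and the
  right one is nonnegative.\<close>

lemma narayana_mult_le: "coeff_le (narayana a * narayana b) (narayana (a + b))"
proof -
  define X Y where "X = {..<a}" and "Y = {a..<a + b}"
  have XY: "finite X" "finite Y" "X \<inter> Y = {}" "card X = a" "card Y = b" by (auto simp: X_def Y_def)
  let ?f = "\<lambda>n K. catalan_monom (card K) * [:1, 1:] ^ (n - card K)"
  have "narayana a * narayana b = (\<Sum>C\<in>Pow X. \<Sum>D\<in>Pow Y. ?f a C * ?f b D)"
    using narayana_eq[OF XY(1)] narayana_eq[OF XY(2)] XY by (simp add: sum_product)
  moreover have "narayana (a + b) = (\<Sum>C\<in>Pow X. \<Sum>D\<in>Pow Y. ?f (a + b) (C \<union> D))"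
    using narayana_eq[of "X \<union> Y"] sum_Pow_Un[OF XY(1-3)] XY by (simp add: card_Un_disjoint)
  moreover have "coeff_le (?f a C * ?f b D) (?f (a + b) (C \<union> D))" if CD: "C \<in> Pow X" "D \<in> Pow Y" for C D
  proof -
    have "card C \<le> a" "card D \<le> b" using CD card_mono[OF XY(1)] card_mono[OF XY(2)] XY by auto
    then have "[:1, 1:] ^ (a - card C) * [:1, 1:] ^ (b - card D) = [:1, 1::int:] ^ (a + b - (card C + card D))"
      by (simp flip: power_add)
    then have "?f a C * ?f b D =
        (catalan_monom (card C) * catalan_monom (card D)) * [:1, 1:] ^ (a + b - (card C + card D))"
      by (metis (no_types) mult.assoc mult.left_commute)
    moreover have "finite C" "finite D" "C \<inter> D = {}" using CD XY finite_subset by auto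
    then have "card (C \<union> D) = card C + card D" by (rule card_Un_disjoint)
    ultimately show ?thesis
      using coeff_le_mult[OF catalan_monom_mult_le coeff_nonneg_one_plus_power] by (simp only:)
  qed
  ultimately show ?thesis by (simp only: coeff_le_sum)
qed

section \<open>Kazhdan--Lusztig polynomials of circuits\<close>

text \<open>
  This is the Kazhdan--Lusztig polynomial of $\mathsf{U}_{n-1,n}$ for $n \ge 2$; the values at 0 and 1 are
  chosen to be 0. The recursion comes from deleting an element of a circuit.
\<close>

fun circuit_KL :: "nat \<Rightarrow> int poly" where
  "circuit_KL 0 = 0"
| "circuit_KL (Suc n) = motzkin n - (if n = 0 then 1 else monom 1 1 * circuit_KL n)"

text \<open>
  The identities for sums over subsets hold without exceptions for small sets if the values of
  \<open>circuit_KL\<close> and of $n \mapsto N_{n-1}$ at 0 are $1/t$. Multiplying by $t$ avoids Laurent polynomials.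
\<close>

definition shifted_circuit_KL :: "nat \<Rightarrow> int poly" where
  "shifted_circuit_KL n = (if n = 0 then 1 else monom 1 1 * circuit_KL n)"

definition shifted_narayana :: "nat \<Rightarrow> int poly" where
  "shifted_narayana n = (if n = 0 then 1 else monom 1 1 * narayana (n - 1))"

lemma motzkin_0: "motzkin 0 = 1"
  by (simp add: motzkin_def catalan_monom_def catalan_def)

lemma narayana_0: "narayana 0 = 1"
  by (simp add: narayana_def catalan_monom_def catalan_def)

lemma circuit_KL_1: "circuit_KL (Suc 0) = 0"
  by (simp add: motzkin_0)

lemma motzkin_eq: "motzkin n = circuit_KL (Suc n) + shifted_circuit_KL n"
  by (simp add: shifted_circuit_KL_def)

declare circuit_KL.simps(2) [simp del]

text \<open>For a fixed element e, the subsets with and without e combine into t times the sum of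
  \<open>circuit_KL (Suc g) + shifted_circuit_KL g\<close>, which is \<open>motzkin g\<close> by the
  recursion.\<close>

lemma twist_shifted_circuit_KL:
  assumes "finite X"
  shows "twist X (\<lambda>G. shifted_circuit_KL (card G)) = shifted_narayana (card X)"
proof (cases "X = {}")
  case False
  then obtain e where "e \<in> X" by blast
  define Y where "Y = X - {e}"
  have X: "X = insert e Y" "e \<notin> Y" "finite Y" using \<open>e \<in> X\<close> assms by (auto simp: Y_def)
  have "twist Y (\<lambda>G. shifted_circuit_KL (card (insert e G))) = twist Y (\<lambda>G. monom 1 1 * circuit_KL (Suc (card G)))"
  proof (intro twist_cong refl)
    fix G assume "G \<subseteq> Y"
    then have "card (insert e G) = Suc (card G)" using X finite_subset by (intro card_insert_disjoint) auto
    then show "shifted_circuit_KL (card (insert e G)) = monom 1 1 * circuit_KL (Suc (card G))" by (simp add: shifted_circuit_KL_def)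
  qed
  then have "twist X (\<lambda>G. shifted_circuit_KL (card G)) =
      monom 1 1 * twist Y (\<lambda>G. circuit_KL (Suc (card G)) + shifted_circuit_KL (card G))"
    unfolding X(1) twist_insert[OF X(3,2)] twist_add twist_mult by (simp only: distrib_left add.commute)
  also have "\<dots> = monom 1 1 * narayana (card Y)"
    unfolding motzkin_eq[symmetric] twist_motzkin[OF X(3)] ..
  finally show ?thesis using X by (simp add: shifted_narayana_def)
qed (simp add: shifted_circuit_KL_def shifted_narayana_def)

text \<open>The subtracted monomial comes from the empty \<open>G\<close>, where
  \<open>circuit_KL\<close> has the value 0 instead of 1/t. In a circuit it is the term that the
  whole ground set contributes as a flat.\<close>

lemma twist_circuit_KL:
  assumes "finite X" "X \<noteq> {}"
  shows "twist X (\<lambda>G. circuit_KL (card G)) = narayana (card X - 1) - monom 1 (card X - 1)"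
proof -
  have n: "card X \<noteq> 0" using assms by simp
  have "twist X (\<lambda>G. if G = {} then 1 else 0) = monom 1 (card X)"
    using assms by (simp add: twist_def sum.delta if_distrib cong: if_cong)
  moreover have "twist X (\<lambda>G. monom 1 1 * circuit_KL (card G)) =
      twist X (\<lambda>G. shifted_circuit_KL (card G) - (if G = {} then 1 else 0))"
  proof (intro twist_cong refl)
    fix G assume "G \<subseteq> X"
    then have "card G = 0 \<longleftrightarrow> G = {}" using finite_subset[OF _ assms(1)] by simp
    then show "monom 1 1 * circuit_KL (card G) = shifted_circuit_KL (card G) - (if G = {} then 1 else 0)"
      by (simp add: shifted_circuit_KL_def)
  qed
  ultimately have "monom 1 1 * twist X (\<lambda>G. circuit_KL (card G)) = shifted_narayana (card X) - monom 1 (card X)"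
    by (simp add: twist_mult twist_diff twist_shifted_circuit_KL[OF assms(1)])
  also have "\<dots> = monom 1 1 * (narayana (card X - 1) - monom 1 (card X - 1))"
    using n by (simp add: shifted_narayana_def right_diff_distrib mult_monom)
  finally show ?thesis by (simp add: monom_eq_0_iff)
qed

text \<open>The coefficient of t^(j+1) in the recursion for \<open>circuit_KL (Suc n)\<close>, with
  \<open>motzkin n\<close> on the right, multiplied by (j + 1)(j + 2) to clear denominators.\<close>

lemma binomial_identity:
  "Suc j * ((n - 2 - j) choose Suc j) * (Suc n choose Suc j) + (j + 2) * ((n - 2 - j) choose j) * (n choose j)
    = Suc j * (n choose (2 * Suc j)) * ((2 * Suc j) choose Suc j)" if "n \<ge> 2"
proof (cases "j \<le> n - 2 - j \<and> j + 2 \<le> n")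
  case False
  \<comment> \<open>If \<open>n - 2 - j\<close> is truncated to 0, then j > 0 because n is at least
    2, and so its binomial coefficients still vanish.\<close>
  then have "n - 2 - j < j \<or> (n - 2 - j = 0 \<and> j > 0)" and "n < 2 * Suc j"
    using that by arith+
  then have *: "(n - 2 - j) choose Suc j = 0" "(n - 2 - j) choose j = 0" "n choose (2 * Suc j) = 0"
    by (auto simp: binomial_eq_0)
  show ?thesis by (simp only: * mult_0 mult_0_right add_0)
next
  case True
  define m where "m = n - 2 - j"
  have nm: "n = m + j + 2" "j \<le> m" using True by (auto simp: m_def)
  define x y c where "x = m choose Suc j" and "y = m choose j" and "c = n choose j"
  have 1: "Suc j * x = (m - j) * y"
  proof -
    have "Suc j * (m choose Suc j) = (m - j) * (m choose j)"
      using binomial_absorb_comp[of m j] binomial_absorption[of j m] by (cases m) simp_all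
    then show ?thesis by (simp add: x_def y_def)
  qed
  have 2: "Suc j * (Suc n choose Suc j) = Suc n * c"
    using Suc_times_binomial_eq[of n j] by (simp add: c_def mult.commute)
  have 3: "Suc j * (n choose Suc j) = (n - j) * c"
    using binomial_absorb_comp[of n j] binomial_absorption[of j n] nm by (simp add: c_def)
  have "(n choose (2 * Suc j)) * ((2 * Suc j) choose Suc j) = (n choose Suc j) * ((n - Suc j) choose (2 * Suc j - Suc j))"
    using nm by (intro choose_mult) auto
  also have "n - Suc j = Suc m" using nm by simp
  also have "2 * Suc j - Suc j = Suc j" by simp
  also have "(Suc m choose Suc j) = x + y" by (simp add: x_def y_def)
  finally have 4: "(n choose (2 * Suc j)) * ((2 * Suc j) choose Suc j) = (n choose Suc j) * (x + y)" .
  have "Suc n * x + (j + 2) * y = (n - j) * (x + y)"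
  proof -
    have e: "n - j = m + 2" "Suc n = (m + 2) + Suc j" using nm by simp_all
    have "Suc n * x + (j + 2) * y = (m + 2) * x + Suc j * x + (j + 2) * y"
      unfolding e by (simp add: algebra_simps)
    also have "\<dots> = (m + 2) * x + ((m - j) + (j + 2)) * y" unfolding 1 by (simp add: algebra_simps)
    also have "(m - j) + (j + 2) = m + 2" using nm by simp
    finally show ?thesis unfolding e by (simp add: algebra_simps)
  qed
  then have "(Suc n * c) * x + (j + 2) * y * c = ((n - j) * c) * (x + y)"
    by (metis (no_types, opaque_lifting) distrib_right mult.assoc mult.commute)
  then have "Suc j * (Suc n choose Suc j) * x + (j + 2) * y * c = Suc j * (n choose Suc j) * (x + y)"
    unfolding 2 3 .
  then show ?thesis
    unfolding mult.assoc 4 m_def[symmetric] x_def[symmetric] y_def[symmetric] c_def[symmetric]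
    by (simp add: mult.assoc mult.commute mult.left_commute)
qed

text \<open>Only needed for the bound on the degree, which the recursion does not show.\<close>

lemma coeff_circuit_KL:
  assumes "n \<ge> 2"
  shows "(int i + 1) * coeff (circuit_KL n) i = int ((n - 2 - i) choose i) * int (n choose i)"
  using assms
proof (induction n arbitrary: i rule: dec_induct)
  case base
  have "circuit_KL 2 = motzkin 1" using circuit_KL.simps(2)[of 1] circuit_KL_1 by (simp add: numeral_2_eq_2)
  then show ?case by (cases i) (simp_all add: coeff_motzkin catalan_def)
next
  case (step n)
  have c: "circuit_KL (Suc n) = motzkin n - monom 1 1 * circuit_KL n" using step by (simp add: circuit_KL.simps)
  show ?case
  proof (cases i)
    case 0
    then show ?thesis by (simp add: c coeff_motzkin catalan_def coeff_monom_mult)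
  next
    case (Suc j)
    let ?C = "catalan (Suc j)" and ?N = "int (n choose (2 * Suc j))"
    have e: "coeff (circuit_KL (Suc n)) i = ?N * ?C - coeff (circuit_KL n) j"
      by (simp add: c coeff_motzkin Suc coeff_monom_mult)
    have "(int j + 1) * ((int i + 1) * coeff (circuit_KL (Suc n)) i) =
        (int j + 1) * ?N * ((int (Suc j) + 1) * ?C) - (int j + 2) * ((int j + 1) * coeff (circuit_KL n) j)"
      unfolding e by (simp add: Suc algebra_simps)
    also have "\<dots> = int (Suc j * (n choose (2 * Suc j)) * ((2 * Suc j) choose Suc j)) -
        int ((j + 2) * ((n - 2 - j) choose j) * (n choose j))"
      unfolding step.IH catalan_binomial by (simp add: algebra_simps)
    also have "\<dots> = int (Suc j * ((n - 2 - j) choose Suc j) * (Suc n choose Suc j))"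
      unfolding binomial_identity[OF step(1), symmetric] by (simp only: of_nat_add)
    also have "\<dots> = (int j + 1) * (int ((Suc n - 2 - i) choose i) * int (Suc n choose i))"
      using step by (simp add: Suc algebra_simps)
    finally show ?thesis by (simp only: mult_cancel_left) linarith
  qed
qed

lemma degree_circuit_KL:
  assumes "n \<ge> 2"
  shows "2 * degree (circuit_KL n) < n - 1"
proof (cases "circuit_KL n = 0")
  case False
  show ?thesis
  proof (rule ccontr)
    let ?i = "degree (circuit_KL n)"
    assume "\<not> 2 * ?i < n - 1"
    then have "n - 2 - ?i < ?i" using assms by linarith
    then have "(int ?i + 1) * coeff (circuit_KL n) ?i = 0" using coeff_circuit_KL[OF assms, of ?i] by (simp add: binomial_eq_0)
    then have "coeff (circuit_KL n) ?i = 0" by simp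
    then show False using False by simp
  qed
qed (use assms in simp)

lemma degree_motzkin: "2 * degree (motzkin n) \<le> n"
proof -
  have "degree (motzkin n) \<le> n div 2"
    by (rule degree_le) (auto simp: coeff_motzkin binomial_eq_0)
  then show ?thesis by simp
qed

text \<open>In the summand of \<open>hook c g\<close> with index j < g one has j + m = g - 1, so the
  bound becomes the rank g - 2 of a matroid of corank 2 on g elements.\<close>

lemma degree_motzkin_circuit_KL:
  assumes "j + m \<ge> 2"
  shows "2 * degree (motzkin j * circuit_KL m) < j + m - 1"
proof (cases "m \<ge> 2")
  case True
  then show ?thesis
    using degree_motzkin[of j] degree_circuit_KL[of m] degree_mult_le[of "motzkin j" "circuit_KL m"] by linarith
next
  case False
  then have "m = 0 \<or> m = Suc 0" by auto
  then have "circuit_KL m = 0" using circuit_KL_1 by auto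
  then show ?thesis using assms by simp
qed

section \<open>Corank two\<close>

text \<open>The contribution of a class of size \<open>c\<close> to the Kazhdan--Lusztig polynomial
  on \<open>g\<close> elements. Its summands are the counterparts of the N_j N_(g-2-j) in the
  Z-polynomial.\<close>

definition hook :: "nat \<Rightarrow> nat \<Rightarrow> int poly" where
  "hook c g = (\<Sum>j<c. motzkin j * circuit_KL (g - Suc j))"

definition shifted_hook :: "nat \<Rightarrow> nat \<Rightarrow> int poly" where
  "shifted_hook c g = (\<Sum>j<c. motzkin j * shifted_circuit_KL (g - Suc j))"

lemma shifted_hook_less: "c < g \<Longrightarrow> shifted_hook c g = monom 1 1 * hook c g"
  by (auto simp: shifted_hook_def hook_def shifted_circuit_KL_def sum_distrib_left intro!: sum.cong)

lemma hook_self: "hook (Suc g) (Suc g) = hook g (Suc g)"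
  by (simp add: hook_def)

text \<open>The last summand contains \<open>shifted_circuit_KL 0 = 1\<close>, whereas
  \<open>circuit_KL 0 = 0\<close> kills it in \<open>hook\<close>. The surplus
  \<open>motzkin g\<close> splits by the recursion; its two parts account for the
  \<open>circuit_KL\<close> corrections in \<open>labelled_KL\<close> and
  \<open>shifted_KL\<close>.\<close>

lemma shifted_hook_self: "shifted_hook (Suc g) (Suc g) = monom 1 1 * hook (Suc g) (Suc g) + circuit_KL (Suc g) + shifted_circuit_KL g"
proof -
  have "shifted_hook (Suc g) (Suc g) = shifted_hook g (Suc g) + motzkin g" by (simp add: shifted_hook_def shifted_circuit_KL_def)
  then show ?thesis by (simp add: shifted_hook_less hook_self motzkin_eq)
qed

text \<open>
  Moving an element of $E$ into $S$ changes the left-hand side by a sum over subsets which splits into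
  a factor for $S$ and a factor for the remaining elements.
\<close>

lemma twist_shifted_hook:
  assumes "finite E" "S \<subseteq> E"
  shows "twist E (\<lambda>G. shifted_hook (card (G \<inter> S)) (card G)) =
    (\<Sum>j<card S. narayana j * shifted_narayana (card E - Suc j))"
proof -
  have "finite S" using assms finite_subset by blast
  then show ?thesis using assms(2)
  proof (induction S rule: finite_induct)
    case empty
    then show ?case by (simp add: shifted_hook_def)
  next
    case (insert e S)
    define X where "X = E - {e}"
    have E: "E = insert e X" "e \<notin> X" "finite X" "S \<subseteq> X" "finite S"
      using insert assms by (auto simp: X_def)
    let ?f = "\<lambda>S G. shifted_hook (card (G \<inter> S)) (card G)"
    have "twist X (?f (insert e S)) = twist X (?f S)"
    proof (intro twist_cong refl)
      fix G assume "G \<subseteq> X"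
      then have "G \<inter> insert e S = G \<inter> S" using E by auto
      then show "?f (insert e S) G = ?f S G" by simp
    qed
    moreover have "twist X (\<lambda>G. ?f (insert e S) (insert e G)) =
        twist X (\<lambda>G. ?f S (insert e G) + motzkin (card (G \<inter> S)) * shifted_circuit_KL (card (G \<inter> (X - S))))"
    proof (intro twist_cong refl)
      fix G assume G: "G \<subseteq> X"
      then have fin: "finite G" "e \<notin> G" using E finite_subset by auto
      have "insert e G \<inter> insert e S = insert e (G \<inter> S)" "insert e G \<inter> S = G \<inter> S"
        using insert by auto
      moreover have "card (insert e G) = Suc (card G)" "card (insert e (G \<inter> S)) = Suc (card (G \<inter> S))"
        using fin by auto
      moreover have "G \<inter> (X - S) = G - (G \<inter> S)" using G by auto
      then have "card (G \<inter> (X - S)) = card G - card (G \<inter> S)"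
        using fin by (simp add: card_Diff_subset)
      ultimately show "?f (insert e S) (insert e G) =
          ?f S (insert e G) + motzkin (card (G \<inter> S)) * shifted_circuit_KL (card (G \<inter> (X - S)))"
        by (simp add: shifted_hook_def)
    qed
    moreover have "twist X (\<lambda>G. motzkin (card (G \<inter> S)) * shifted_circuit_KL (card (G \<inter> (X - S)))) =
        narayana (card S) * shifted_narayana (card (X - S))"
    proof -
      have "S \<union> (X - S) = X" using E by auto
      then have "twist X (\<lambda>G. motzkin (card (G \<inter> S)) * shifted_circuit_KL (card (G \<inter> (X - S)))) =
          twist S (\<lambda>G. motzkin (card G)) * twist (X - S) (\<lambda>G. shifted_circuit_KL (card G))"
        using twist_Un[of S "X - S" "\<lambda>G. motzkin (card G)" "\<lambda>G. shifted_circuit_KL (card G)"] E by simp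
      then show ?thesis using E by (simp add: twist_motzkin twist_shifted_circuit_KL)
    qed
    moreover have "card (X - S) = card E - Suc (card S)" using E by (simp add: card_Diff_subset)
    ultimately have "twist E (?f (insert e S)) =
        twist E (?f S) + narayana (card S) * shifted_narayana (card E - Suc (card S))"
      unfolding E(1) twist_insert[OF E(3,2)] by (simp add: twist_add)
    then show ?case using insert by simp
  qed
qed


section \<open>Candidates for the Kazhdan--Lusztig and Z-polynomials\<close>

text \<open>The three cases are the coranks 0, 1 and 2 of a labelled matroid with ground set
  \<open>G\<close>.\<close>

definition labelled_KL :: "('a \<Rightarrow> 'b) \<Rightarrow> 'a set \<Rightarrow> int poly" where
  "labelled_KL k G = (if G = {} then 1 else if card (k ` G) = 1 then circuit_KL (card G) else
     (\<Sum>s\<in>k ` G. hook (card (G \<inter> k -` {s})) (card G)) - hook (card G) (card G) - circuit_KL (card G - 1))"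

text \<open>With one class the two \<open>shifted_hook\<close> terms cancel and
  \<open>circuit_KL\<close> is left. With more classes \<open>circuit_KL (card G)\<close> cancels
  against a part of the last \<open>shifted_hook\<close>, and t times \<open>labelled_KL\<close> is
  left.\<close>

definition shifted_KL :: "('a \<Rightarrow> 'b) \<Rightarrow> 'a set \<Rightarrow> int poly" where
  "shifted_KL k G = (\<Sum>s\<in>k ` G. shifted_hook (card (G \<inter> k -` {s})) (card G)) - shifted_hook (card G) (card G) + circuit_KL (card G)"

definition labelled_Z :: "('a \<Rightarrow> 'b) \<Rightarrow> 'a set \<Rightarrow> int poly" where
  "labelled_Z k E = (\<Sum>s\<in>k ` E. \<Sum>j<card (E \<inter> k -` {s}). narayana j * narayana (card E - 2 - j))
     - (\<Sum>j<card E - 1. narayana j * narayana (card E - 2 - j))"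

lemma fibre_eq: "k ` G = {s} \<Longrightarrow> G \<inter> k -` {s} = G"
  by auto

lemma shifted_KL_empty: "shifted_KL k {} = 0"
  by (simp add: shifted_KL_def shifted_hook_def)

lemma shifted_KL_one:
  assumes "card (k ` G) = 1"
  shows "shifted_KL k G = labelled_KL k G"
proof -
  obtain s where s: "k ` G = {s}" using assms card_1_singletonE by blast
  then have "G \<noteq> {}" by auto
  then show ?thesis using s by (simp add: shifted_KL_def labelled_KL_def fibre_eq)
qed

lemma fibre_less:
  assumes "finite G" "card (k ` G) \<ge> 2" "s \<in> k ` G"
  shows "card (G \<inter> k -` {s}) < card G"
proof (intro psubset_card_mono assms psubsetI)
  show "G \<inter> k -` {s} \<noteq> G"
  proof
    assume "G \<inter> k -` {s} = G"
    then have "k ` G \<subseteq> {s}" by auto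
    then have "card (k ` G) \<le> card {s}" by (intro card_mono) auto
    then show False using assms(2) by simp
  qed
qed simp

lemma shifted_KL_two:
  assumes G: "finite G" "card (k ` G) \<ge> 2"
  shows "shifted_KL k G = monom 1 1 * labelled_KL k G"
proof -
  have ge: "card G \<ge> 2" using G card_image_le[OF G(1), of k] by linarith
  then obtain g where g: "card G = Suc g" "g \<noteq> 0" by (cases "card G") auto
  have ne: "G \<noteq> {}" "card (k ` G) \<noteq> 1" using G ge by auto
  have "(\<Sum>s\<in>k ` G. shifted_hook (card (G \<inter> k -` {s})) (card G)) =
      monom 1 1 * (\<Sum>s\<in>k ` G. hook (card (G \<inter> k -` {s})) (card G))"
    unfolding sum_distrib_left by (intro sum.cong refl shifted_hook_less fibre_less G)
  then have "shifted_KL k G = monom 1 1 * (\<Sum>s\<in>k ` G. hook (card (G \<inter> k -` {s})) (card G))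
      - monom 1 1 * hook (card G) (card G) - monom 1 1 * circuit_KL (card G - 1)"
    unfolding shifted_KL_def using g shifted_hook_self[of g] by (simp add: shifted_circuit_KL_def)
  then show ?thesis using ne by (simp add: labelled_KL_def right_diff_distrib)
qed

lemma twist_shifted_KL:
  assumes E: "finite E" "card (k ` E) \<ge> 2"
  shows "twist E (shifted_KL k) = monom 1 1 * labelled_Z k E - monom 1 (card E - 1)"
proof -
  have "card E \<ge> 2" using E card_image_le[OF E(1), of k] by linarith
  then obtain n where n: "card E = Suc n" "n \<noteq> 0" by (cases "card E") auto
  have tn: "narayana j * shifted_narayana (card E - Suc j) = monom 1 1 * (narayana j * narayana (card E - 2 - j))"
    if "j < n" for j
  proof -
    have "card E - Suc j - 1 = card E - 2 - j" "card E - Suc j \<noteq> 0" using that n by auto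
    then show ?thesis by (simp add: shifted_narayana_def mult.left_commute)
  qed
  have "twist E (\<lambda>G. \<Sum>s\<in>k ` G. shifted_hook (card (G \<inter> k -` {s})) (card G)) =
      twist E (\<lambda>G. \<Sum>s\<in>k ` E. shifted_hook (card (G \<inter> (E \<inter> k -` {s}))) (card G))"
  \<comment> \<open>Labels absent from \<open>G\<close> contribute an empty
    \<open>shifted_hook\<close>, so the range of \<open>s\<close> can be made independent of
    \<open>G\<close> and the sums exchanged.\<close>
  proof (intro twist_cong refl)
    fix G assume G: "G \<subseteq> E"
    have "(\<Sum>s\<in>k ` G. shifted_hook (card (G \<inter> k -` {s})) (card G)) =
        (\<Sum>s\<in>k ` E. shifted_hook (card (G \<inter> k -` {s})) (card G))"
    proof (rule sum.mono_neutral_left)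
      show "\<forall>s\<in>k ` E - k ` G. shifted_hook (card (G \<inter> k -` {s})) (card G) = 0"
      proof
        fix s assume "s \<in> k ` E - k ` G"
        then have "G \<inter> k -` {s} = {}" by blast
        then show "shifted_hook (card (G \<inter> k -` {s})) (card G) = 0" by (simp add: shifted_hook_def)
      qed
    qed (use G E in auto)
    moreover have "G \<inter> (E \<inter> k -` {s}) = G \<inter> k -` {s}" for s using G by auto
    ultimately show "(\<Sum>s\<in>k ` G. shifted_hook (card (G \<inter> k -` {s})) (card G)) =
        (\<Sum>s\<in>k ` E. shifted_hook (card (G \<inter> (E \<inter> k -` {s}))) (card G))" by simp
  qed
  also have "\<dots> = (\<Sum>s\<in>k ` E. \<Sum>j<card (E \<inter> k -` {s}). narayana j * shifted_narayana (card E - Suc j))"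
    unfolding twist_sum by (intro sum.cong refl twist_shifted_hook E) simp
  also have "\<dots> = (\<Sum>s\<in>k ` E. \<Sum>j<card (E \<inter> k -` {s}). monom 1 1 * (narayana j * narayana (card E - 2 - j)))"
    using fibre_less[OF E] n by (intro sum.cong refl tn) force
  finally have 1: "twist E (\<lambda>G. \<Sum>s\<in>k ` G. shifted_hook (card (G \<inter> k -` {s})) (card G)) = \<dots>" .
  have "twist E (\<lambda>G. shifted_hook (card G) (card G)) = twist E (\<lambda>G. shifted_hook (card (G \<inter> E)) (card G))"
    by (intro twist_cong refl) (simp add: Int_absorb2)
  also have "\<dots> = (\<Sum>j<Suc n. narayana j * shifted_narayana (card E - Suc j))"
    using twist_shifted_hook[OF E(1) subset_refl] n by simp
  \<comment> \<open>The summand j = n meets \<open>shifted_narayana 0 = 1\<close>; the resulting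
    \<open>narayana n\<close> cancels against the one in fact 3, whose monomial survives.\<close>
  also have "\<dots> = (\<Sum>j<n. monom 1 1 * (narayana j * narayana (card E - 2 - j))) + narayana n"
  proof -
    have "narayana n * shifted_narayana (card E - Suc n) = narayana n" using n by (simp add: shifted_narayana_def)
    moreover have "(\<Sum>j<n. narayana j * shifted_narayana (card E - Suc j)) =
        (\<Sum>j<n. monom 1 1 * (narayana j * narayana (card E - 2 - j)))"
      by (intro sum.cong refl tn) simp
    ultimately show ?thesis by (simp only: sum.lessThan_Suc)
  qed
  finally have 2: "twist E (\<lambda>G. shifted_hook (card G) (card G)) = \<dots>" .
  have 3: "twist E (\<lambda>G. circuit_KL (card G)) = narayana n - monom 1 n"
  proof -
    have "E \<noteq> {}" using n by auto
    then show ?thesis using twist_circuit_KL[OF E(1)] n by simp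
  qed
  show ?thesis unfolding shifted_KL_def twist_add twist_diff 1 2 3 labelled_Z_def
    using n by (simp add: sum_distrib_left right_diff_distrib)
qed

lemma palindromic_labelled_Z:
  assumes E: "finite E" "card (k ` E) \<ge> 2"
  shows "palindromic (card E - 2) (labelled_Z k E)"
proof -
  have *: "palindromic (card E - 2) (narayana j * narayana (card E - 2 - j))" if "j < card E - 1" for j
  proof -
    have "j + (card E - 2 - j) = card E - 2" using that by simp
    then show ?thesis using palindromic_mult[OF palindromic_narayana palindromic_narayana] by metis
  qed
  show ?thesis unfolding labelled_Z_def
    using fibre_less[OF E] by (intro palindromic_diff palindromic_sum *) force+
qed

lemma degree_labelled_KL:
  assumes G: "finite G" "card (k ` G) \<ge> 2" "card G \<ge> 3"
  shows "2 * degree (labelled_KL k G) < card G - 2"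
proof -
  \<comment> \<open>The largest m with 2m < |G| - 2, which turns the strict bound into one that
    passes to sums and differences.\<close>
  define d where "d = (card G - 3) div 2"
  have d: "2 * m < card G - 2 \<longleftrightarrow> m \<le> d" for m using G(3) by (auto simp: d_def)
  have "degree (motzkin j * circuit_KL (card G - Suc j)) \<le> d" if "j < card G" for j
    unfolding d[symmetric] using degree_motzkin_circuit_KL[of j "card G - Suc j"] that G(3) by simp linarith
  then have hk: "degree (hook c (card G)) \<le> d" if "c \<le> card G" for c
    unfolding hook_def using that by (intro degree_sum_le) auto
  have "degree (circuit_KL (card G - 1)) \<le> d"
    unfolding d[symmetric] using degree_circuit_KL[of "card G - 1"] G(3) by simp linarith
  moreover have "degree (\<Sum>s\<in>k ` G. hook (card (G \<inter> k -` {s})) (card G)) \<le> d"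
    using G by (intro degree_sum_le hk card_mono) auto
  ultimately have "degree (labelled_KL k G) \<le> d"
    using G hk by (auto simp: labelled_KL_def intro!: degree_diff_le)
  then show ?thesis by (simp add: d)
qed

text \<open>Lets sums over flats, whose complements are the sets $G$ here, run over all subsets.\<close>

lemma labelled_KL_nonflat:
  assumes G: "finite G" "x \<in> G" and c: "min 2 (card (k ` G)) = Suc (min 2 (card (k ` (G - {x}))))"
  shows "labelled_KL k G = 0"
proof (cases "G = {x}")
  case True
  then show ?thesis by (simp add: labelled_KL_def circuit_KL_1)
next
  case False
  then have "G - {x} \<noteq> {}" using G by blast
  then have "card (k ` (G - {x})) \<noteq> 0" using G(1) by simp
  then have c1: "card (k ` (G - {x})) = 1" and c2: "card (k ` G) \<ge> 2" using c by linarith+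
  obtain s where s: "k ` (G - {x}) = {s}" using c1 card_1_singletonE by blast
  have kG: "k ` G = insert (k x) {s}" using s G(2) by (metis image_insert insert_Diff)
  then have ne: "k x \<noteq> s" using c2 by auto
  define g where "g = card G - 1"
  have g: "card G = Suc g" "card (G - {x}) = g" using G card_gt_0_iff[of G] by (auto simp: g_def)
  have "k y = s" if "y \<in> G" "y \<noteq> x" for y using s that by blast
  then have "G \<inter> k -` {s} = G - {x}" "G \<inter> k -` {k x} = {x}" using ne G(2) by fastforce+
  \<comment> \<open>Here \<open>G\<close> has exactly two classes, one of them {x}. The hook of the
    singleton cancels \<open>circuit_KL (card G - 1)\<close>, and the other hook cancels
    \<open>hook (card G) (card G)\<close>.\<close>
  then have "(\<Sum>s\<in>k ` G. hook (card (G \<inter> k -` {s})) (card G)) = hook 1 (Suc g) + hook g (Suc g)"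
    unfolding kG using ne g by simp
  moreover have "hook 1 (Suc g) = circuit_KL g" by (simp add: hook_def motzkin_0)
  moreover have "G \<noteq> {}" "card (k ` G) \<noteq> 1" using c2 by auto
  ultimately show ?thesis using g by (simp add: labelled_KL_def hook_self)
qed

section \<open>Comparison with the uniform matroid\<close>

lemma coeff_le_labelled_Z:
  assumes E: "finite E" "card (k ` E) \<ge> 2"
  shows "coeff_le (labelled_Z k E) (labelled_Z (\<lambda>x. x) {..<card E})"
proof -
  define n where "n = card E"
  let ?N = "narayana (n - 2)" and ?f = "\<lambda>j. narayana j * narayana (n - 2 - j)"
  have le: "coeff_le (?f j) ?N" if "j < n - 1" for j
    using narayana_mult_le[of j "n - 2 - j"] that by simp
  have "n \<ge> 2" using E card_image_le[OF E(1), of k] by (simp add: n_def)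
  \<comment> \<open>With at least two classes no class has all n elements, so j < n - 1 and the
    indices j and n - 2 - j add up to n - 2 without truncation.\<close>
  have "coeff_le (\<Sum>s\<in>k ` E. \<Sum>j<card (E \<inter> k -` {s}). ?f j)
      (\<Sum>s\<in>k ` E. \<Sum>j<card (E \<inter> k -` {s}). ?N)"
    using fibre_less[OF E] by (intro coeff_le_sum le) (force simp: n_def)
  also have "(\<Sum>s\<in>k ` E. \<Sum>j<card (E \<inter> k -` {s}). ?N) = of_nat (\<Sum>s\<in>k ` E. card (E \<inter> k -` {s})) * ?N"
    by (simp add: sum_distrib_right)
  also have "(\<Sum>s\<in>k ` E. card (E \<inter> k -` {s})) = n"
  proof -
    have "n = (\<Sum>s\<in>k ` E. card {x \<in> E. k x = s})"
      unfolding n_def card_eq_sum using sum.image_gen[OF E(1), of "\<lambda>_. 1::nat" k] by simp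
    moreover have "{x \<in> E. k x = s} = E \<inter> k -` {s}" for s by auto
    ultimately show ?thesis by simp
  qed
  also have "of_nat n * ?N = (\<Sum>s\<in>{..<n}. \<Sum>j<card ({..<n} \<inter> (\<lambda>x. x) -` {s}). ?f j)"
  proof -
    have "{..<n} \<inter> (\<lambda>x. x) -` {s} = {s}" if "s < n" for s using that by auto
    then show ?thesis by (simp add: narayana_0)
  qed
  finally show ?thesis by (simp add: labelled_Z_def coeff_le_def flip: n_def)
qed

text \<open>Needed when \<open>M\<close> has loops and its Z-polynomial is 0. The polynomial is
  N_(n-2) plus the sum of the nonnegative differences N_(n-2) - N_j N_(n-2-j) over j < n -
  1.\<close>

lemma coeff_nonneg_labelled_Z:
  fixes n :: nat
  assumes "n \<ge> 2"
  shows "coeff_le 0 (labelled_Z (\<lambda>x. x) {..<n})"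
proof -
  let ?N = "narayana (n - 2)" and ?f = "\<lambda>j. narayana j * narayana (n - 2 - j)"
  have "coeff_le (?f j) ?N" if "j < n - 1" for j
    using narayana_mult_le[of j "n - 2 - j"] that by simp
  then have "coeff_le (\<Sum>j<n - 1. ?f j) (\<Sum>j<n - 1. ?N)" by (intro coeff_le_sum) simp
  moreover have "(\<Sum>s\<in>{..<n}. \<Sum>j<card ({..<n} \<inter> (\<lambda>x. x) -` {s}). ?f j) = (\<Sum>j<n. ?N)"
  proof (intro sum.cong refl)
    fix s assume "s \<in> {..<n}"
    then have "{..<n} \<inter> (\<lambda>x. x) -` {s} = {s}" by auto
    then show "(\<Sum>j<card ({..<n} \<inter> (\<lambda>x. x) -` {s}). ?f j) = ?N" by (simp add: narayana_0)
  qed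
  moreover have "(\<Sum>j<n. ?N) = (\<Sum>j<n - 1. ?N) + ?N"
    using assms sum.lessThan_Suc[of "\<lambda>_. ?N" "n - 1"] by simp
  ultimately have "labelled_Z (\<lambda>x. x) {..<n} = ((\<Sum>j<n - 1. ?N) - (\<Sum>j<n - 1. ?f j)) + ?N"
    and "coeff_le 0 ((\<Sum>j<n - 1. ?N) - (\<Sum>j<n - 1. ?f j))"
    by (simp_all add: labelled_Z_def coeff_le_def narayana_0)
  then show ?thesis using coeff_nonneg_narayana[of "n - 2"] unfolding coeff_le_def
    by (simp only: coeff_add coeff_0 add_nonneg_nonneg simp_thms)
qed


section \<open>Summation over flats and identification of the polynomials\<close>

text \<open>The labelling equation gives the rank of E - G from |E - G| and the number of labels on
  \<open>G\<close>, which makes the sum a \<open>twist\<close> of \<open>circuit_KL\<close> in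
  corank 1 and, after multiplication by t, of \<open>shifted_KL\<close> in corank 2. Only the empty
  \<open>G\<close> does not fit, as both functions vanish there; the separate monomial t^(|E|-1)
  restores it.\<close>

lemma Z_sum_labelled_KL:
  assumes L: "series_labelling k M" and ne: "ground M \<noteq> {}"
  shows "Z_sum (\<lambda>N. labelled_KL k (ground N)) M =
    (if card (k ` ground M) = 1 then narayana (card (ground M) - 1) else labelled_Z k (ground M))"
proof -
  define E where "E = ground M"
  have M: "matroid M" using L by (simp add: series_labelling_def)
  have fin: "finite E" using matroid_indepD(1)[OF M] by (simp add: E_def)
  have finG: "finite G" if "G \<subseteq> E" for G using that fin finite_subset by blast
  have rk: "card G + rk M (E - G) = rank M + min 2 (card (k ` G))" if "G \<subseteq> E" for G
    using L that by (auto simp: series_labelling_def E_def)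
  have rk_E: "card E = rank M + min 2 (card (k ` E))" using rk[of E] rk_empty[OF M] by simp
  have kE: "card (k ` E) \<noteq> 0" using ne fin by (simp add: E_def)
  have nonflat: "labelled_KL k (E - F) = 0" if F: "F \<subseteq> E" "F \<notin> flats M" for F
  proof -
    \<comment> \<open>An element outside \<open>F\<close> that does not raise the rank of
      \<open>F\<close> is one whose removal from E - F lowers the dual rank.\<close>
    obtain x where x: "x \<in> E - F" "rk M (insert x F) \<le> rk M F"
      using F unfolding flats_def E_def by force
    have "E - (E - F) = F" "E - (E - F - {x}) = insert x F" using F x by auto
    moreover have "Suc (card (E - F - {x})) = card (E - F)"
      using x fin by (intro card_Suc_Diff1) auto
    moreover have "rk M F \<le> rk M (insert x F)" by (intro rk_mono[OF M]) auto
    moreover have "E - F - {x} \<subseteq> E" "E - F \<subseteq> E" by auto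
    ultimately have "min 2 (card (k ` (E - F))) = Suc (min 2 (card (k ` (E - F - {x}))))"
      using rk[of "E - F"] rk[of "E - F - {x}"] x(2) by simp
    then show ?thesis using x fin by (intro labelled_KL_nonflat[of _ x]) auto
  qed
  have "Z_sum (\<lambda>N. labelled_KL k (ground N)) M = (\<Sum>F\<in>flats M. monom 1 (rk M F) * labelled_KL k (E - F))"
    by (simp add: Z_sum_def contract_def E_def)
  also have "\<dots> = (\<Sum>F\<in>Pow E. monom 1 (rk M F) * labelled_KL k (E - F))"
    using nonflat fin by (intro sum.mono_neutral_left) (auto simp: flats_def E_def)
  also have "\<dots> = (\<Sum>G\<in>Pow E. monom 1 (rk M (E - G)) * labelled_KL k G)"
    by (rule sum.reindex_bij_witness[of _ "\<lambda>G. E - G" "\<lambda>G. E - G"]) (auto simp: double_diff)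
  finally have Z: "Z_sum (\<lambda>N. labelled_KL k (ground N)) M = (\<Sum>G\<in>Pow E. monom 1 (rk M (E - G)) * labelled_KL k G)" .
  have cd: "card (E - G) = card E - card G" "card G \<le> card E" if "G \<subseteq> E" for G
    using that finG fin by (auto simp: card_Diff_subset card_mono)
  show ?thesis
  proof (cases "card (k ` E) = 1")
    case True
    have "monom 1 (rk M (E - G)) * labelled_KL k G =
        monom 1 (card (E - G)) * circuit_KL (card G) + (if G = {} then monom 1 (card E - 1) else 0)"
      if G: "G \<subseteq> E" for G
    proof (cases "G = {}")
      case True
      then show ?thesis using rk_E \<open>card (k ` E) = 1\<close> by (simp add: labelled_KL_def rank_def E_def)
    next
      case False
      have "card (k ` G) \<le> 1" using True card_mono[of "k ` E" "k ` G"] G fin by auto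
      moreover have "card (k ` G) \<noteq> 0" using False finG[OF G] by simp
      ultimately have kG: "card (k ` G) = 1" by simp
      then have "rk M (E - G) = card (E - G)" using rk[OF G] rk_E True cd[OF G] by simp
      then show ?thesis using False kG by (simp add: labelled_KL_def)
    qed
    then have "Z_sum (\<lambda>N. labelled_KL k (ground N)) M =
        (\<Sum>G\<in>Pow E. monom 1 (card (E - G)) * circuit_KL (card G) + (if G = {} then monom 1 (card E - 1) else 0))"
      unfolding Z by (intro sum.cong refl) (simp only: Pow_iff)
    also have "\<dots> = twist E (\<lambda>G. circuit_KL (card G)) + monom 1 (card E - 1)"
      using fin by (simp add: sum.distrib twist_def)
    also have "\<dots> = narayana (card E - 1)"
      using twist_circuit_KL[OF fin] ne by (simp add: E_def)
    finally show ?thesis using True by (simp add: E_def)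
  next
    case False
    then have two: "card (k ` E) \<ge> 2" using kE by linarith
    have "monom 1 1 * (monom 1 (rk M (E - G)) * labelled_KL k G) =
        monom 1 (card (E - G)) * shifted_KL k G + (if G = {} then monom 1 (card E - 1) else 0)"
      if G: "G \<subseteq> E" for G
    proof -
      have r: "rk M (E - G) + 2 = card (E - G) + min 2 (card (k ` G))"
        using rk[OF G] rk_E two cd[OF G] by simp
      have "card (k ` G) = 0 \<Longrightarrow> G = {}" using finG[OF G] by simp
      then consider "G = {}" | "card (k ` G) = 1" | "card (k ` G) \<ge> 2" by linarith
      then show ?thesis
      proof cases
        case 1
        then have "Suc (rk M E) = card E - 1" using r cd[OF G] by simp
        then show ?thesis using 1 by (simp add: labelled_KL_def shifted_KL_empty mult_monom)
      next
        case 2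
        then have "Suc (rk M (E - G)) = card (E - G)" using r by simp
        moreover have "G \<noteq> {}" using 2 by auto
        ultimately show ?thesis using shifted_KL_one[OF 2] by (simp add: mult_monom flip: mult.assoc)
      next
        case 3
        then have "rk M (E - G) = card (E - G)" using r by simp
        moreover have "G \<noteq> {}" using 3 by auto
        ultimately show ?thesis using shifted_KL_two[OF finG[OF G] 3] by (simp add: mult.left_commute)
      qed
    qed
    then have "monom 1 1 * Z_sum (\<lambda>N. labelled_KL k (ground N)) M =
        (\<Sum>G\<in>Pow E. monom 1 (card (E - G)) * shifted_KL k G + (if G = {} then monom 1 (card E - 1) else 0))"
      unfolding Z sum_distrib_left by (intro sum.cong refl) (simp only: Pow_iff)
    also have "\<dots> = twist E (shifted_KL k) + monom 1 (card E - 1)"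
      using fin by (simp add: sum.distrib twist_def)
    also have "\<dots> = monom 1 1 * labelled_Z k E" by (simp add: twist_shifted_KL[OF fin two])
    finally show ?thesis using False by (simp add: E_def monom_eq_0_iff)
  qed
qed

text \<open>By induction both candidates for the polynomial of \<open>M\<close> are completed to a
  palindromic sum by the same \<open>q\<close>, the contribution of the nonempty flats. The degree
  bounds then force them to agree.\<close>

lemma KL_poly_labelled:
  assumes "series_labelling k M" "loopless M"
  shows "KL_poly M = labelled_KL k (ground M)"
  using assms
proof (induction "card (ground M)" arbitrary: M rule: less_induct)
  case less
  have M: "matroid M" using less by (simp add: series_labelling_def)
  have fin: "finite (ground M)" by (rule matroid_indepD(1)[OF M])
  have rk_E: "card (ground M) = rank M + min 2 (card (k ` ground M))"
    using less(2) rk_empty[OF M] by (force simp: series_labelling_def)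
  show ?case
  proof (cases "rank M = 0")
    case True
    then have "ground M = {}" using rank_0_ground[OF M less(3)] by simp
    then show ?thesis using KL_familyD(2)[OF KL_family_KL_poly M less(3) True] by (simp add: labelled_KL_def)
  next
    case False
    then have ne: "ground M \<noteq> {}" using rk_E by auto
    then have c0: "card (k ` ground M) \<noteq> 0" using fin by simp
    define q where "q = (\<Sum>F\<in>flats M - {{}}. monom 1 (rk M F) * KL_poly (contract M F))"
    have "KL_poly (contract M F) = labelled_KL k (ground (contract M F))" if F: "F \<in> flats M - {{}}" for F
    proof (rule less(1))
      show "card (ground (contract M F)) < card (ground M)" by (rule card_contract_less[OF M F])
      show "series_labelling k (contract M F)"
        using F by (intro series_labelling_contract less) (auto simp: flats_def)
      show "loopless (contract M F)" using F by (intro loopless_contract[OF M]) simp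
    qed
    then have q: "q = (\<Sum>F\<in>flats M - {{}}. monom 1 (rk M F) * labelled_KL k (ground (contract M F)))"
      unfolding q_def by (intro sum.cong refl) simp
    have "palindromic (rank M) (KL_poly M + q)"
      using KL_familyD(4)[OF KL_family_KL_poly M less(3)] Z_sum_split[OF M less(3)] by (simp add: q_def)
    moreover have "palindromic (rank M) (labelled_KL k (ground M) + q)"
    proof -
      have "labelled_KL k (ground M) + q = Z_sum (\<lambda>N. labelled_KL k (ground N)) M"
        using Z_sum_split[OF M less(3), of "\<lambda>N. labelled_KL k (ground N)"] by (simp add: q)
      also have "\<dots> = (if card (k ` ground M) = 1 then narayana (card (ground M) - 1) else labelled_Z k (ground M))"
        by (rule Z_sum_labelled_KL[OF less(2) ne])
      finally show ?thesis
        using rk_E c0 palindromic_narayana[of "card (ground M) - 1"] palindromic_labelled_Z[OF fin, of k]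
        by (cases "card (k ` ground M) = 1") auto
    qed
    moreover have "2 * degree (KL_poly M) < rank M"
      using KL_familyD(3)[OF KL_family_KL_poly M less(3)] False by simp
    moreover have "2 * degree (labelled_KL k (ground M)) < rank M"
    proof (cases "card (k ` ground M) = 1")
      case True
      then show ?thesis using rk_E False ne degree_circuit_KL[of "card (ground M)"] by (simp add: labelled_KL_def)
    next
      case c: False
      then show ?thesis using rk_E False c0 degree_labelled_KL[OF fin, of k] by simp
    qed
    ultimately show ?thesis by (rule palindromic_unique)
  qed
qed

lemma Z_poly_labelled:
  assumes L: "series_labelling k M" and ll: "loopless M" and c: "card (k ` ground M) \<ge> 2"
  shows "Z_poly M = labelled_Z k (ground M)"
proof -
  have M: "matroid M" using L by (simp add: series_labelling_def)
  have "KL_poly (contract M F) = labelled_KL k (ground (contract M F))" if "F \<in> flats M" for F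
    using that by (intro KL_poly_labelled series_labelling_contract[OF L] loopless_contract[OF M])
      (auto simp: flats_def)
  then have "Z_sum KL_poly M = Z_sum (\<lambda>N. labelled_KL k (ground N)) M"
    unfolding Z_sum_def by (intro sum.cong refl) simp
  moreover have "ground M \<noteq> {}" using c by auto
  ultimately show ?thesis using M ll c Z_sum_labelled_KL[OF L] by (simp add: Z_poly_def)
qed

theorem theorem9p10:
  fixes M :: "'a set_system" and n :: nat
  assumes "matroid M" and "coloopless M" and "corank M = 2" and "card (ground M) = n"
  shows "\<forall>i. coeff (Z_poly M) i \<le> coeff (Z_poly (uniform_matroid (n - 2) n)) i"
proof -
  obtain k :: "'a \<Rightarrow> 'a set" where k: "series_labelling k M"
    using series_labelling_exists[OF assms(1-3)] by blast
  have fin: "finite (ground M)" by (rule matroid_indepD(1)[OF assms(1)])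
  have n: "n = rank M + min 2 (card (k ` ground M))"
    using k rk_empty[OF assms(1)] assms(4) by (force simp: series_labelling_def)
  then have c: "card (k ` ground M) \<ge> 2" and n2: "n \<ge> 2"
    using assms(3,4) by (auto simp: corank_def)
  \<comment> \<open>For n = 2 the uniform matroid has rank 0 and consists of two loops, so its
    Z-polynomial is 0 by convention and not given by \<open>labelled_Z\<close>.\<close>
  let ?U = "uniform_matroid (n - 2) n"
  have U: "Z_poly ?U = labelled_Z (\<lambda>x. x) {..<n}" if "n \<noteq> 2"
  proof -
    have g: "ground ?U = {..<n}" by (simp add: uniform_matroid_def)
    have "loopless ?U" using n2 that by (auto simp: loopless_def uniform_matroid_def)
    then show ?thesis using Z_poly_labelled[OF series_labelling_uniform[OF n2]] n2 by (simp add: g)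
  qed
  have "coeff_le (Z_poly M) (Z_poly ?U)"
  proof (cases "loopless M")
    case True
    have "n \<noteq> 2"
    proof
      assume "n = 2"
      then have "rank M = 0" using n c by simp
      then show False using rank_0_ground[OF assms(1) True] assms(4) n2 by simp
    qed
    then show ?thesis using Z_poly_labelled[OF k True c] U coeff_le_labelled_Z[OF fin c] assms(4) by simp
  next
    case False
    then have 0: "Z_poly M = 0" by (simp add: Z_poly_def)
    show ?thesis
    proof (cases "n = 2")
      case True
      then have "\<not> loopless ?U"
        by (auto simp: loopless_def uniform_matroid_def intro: exI[of _ "0::nat"])
      then show ?thesis using 0 by (simp add: Z_poly_def coeff_le_refl)
    qed (simp add: 0 U coeff_nonneg_labelled_Z n2)
  qed
  then show ?thesis by (simp add: coeff_le_def)
qed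

end
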